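(* Let $\mu$ be a probability measure on $\mathbb{R}\times\mathbb{R}^+$ and let $(B,A)$ be a random pair with law $\mu$. Assume: (i) $\mathbb{E}\log A=0$; (ii) $A\not\equiv 1$ (i.e. it is not the case that $A=1$ almost surely); (iii) $\mathbb{P}[Ax+B=x]<1$ for all $x\in\mathbb{R}$; (iv) $\mathbb{E}\big[(|\log A|+\log^+|B|)^{2+\delta'}\big]<\infty$ for some $\delta'>0$; (v) the closed semigroup generated by the support of $\mu$ is the whole group $G=\mathbb{R}\rtimes\mathbb{R}^+$; and moreover that there exists a constant $\delta>0$ such that (vi) $\mathbb{E}A^{\delta}<\infty$ and $\mathbb{E}A^{-\delta}<\infty$; (vii) $\mathbb{E}|B|^{\delta}<\infty$; and that (viii) $\mu_A$ (the law of $A$) is spread-out. Let $\nu$ be the (unique up to a constant factor) invariant Radon measure on $\mathbb{R}$ of the process $X_n=A_nX_{n-1}+B_n$, where $(B_n,A_n)$ are i.i.d. with law $\mu$. Then there are constants $C_+$ and $C_-$ such that for all positive numbers $\alpha<\beta$, $$\lim_{x\to+\infty}\nu((\alpha x,\beta x])=\log(\beta/\alpha)\cdot C_+,\qquad \lim_{x\to-\infty}\nu((\beta x,\alpha x])=\log(\beta/\alpha)\cdot C_-.$$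
   Context: $\mathbb{R}^+=(0,\infty)$. $G=\mathbb{R}\rtimes\mathbb{R}^+$ is the "$ax+b$" group with multiplication $(b,a)\cdot(b',a')=(b+ab',aa')$, acting on $\mathbb{R}$ by $(b,a)\circ x=ax+b$. A Radon measure $\nu$ on $\mathbb{R}$ (nonzero) is invariant for the process if $\int_{\mathbb{R}\times\mathbb{R}^+}\int_{\mathbb{R}}f(ax+b)\,d\nu(x)\,d\mu(b,a)=\int f\,d\nu$ for every nonnegative measurable $f$ on $\mathbb{R}$. Under (i)-(iv) such a measure exists and is unique up to a constant factor (known theorem of Babillot, Bougerol and Elie). A measure on $\mathbb{R}^+$ is spread-out if some convolution power of it (with respect to multiplication) has a nonsingular component relative to the Haar measure of $\mathbb{R}^+$. *)

theory Defs
  imports "HOL-Probability.Probability"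
begin

text \<open>The group \<open>G = \<real> \<rtimes> \<real>\<^sup>+\<close>; the pair \<open>(b, a)\<close> stands for the map \<open>x \<mapsto> a x + b\<close>.\<close>

definition affine_group :: "(real \<times> real) set" where
  "affine_group = UNIV \<times> {0<..}"

definition affine_mult :: "real \<times> real \<Rightarrow> real \<times> real \<Rightarrow> real \<times> real" where
  "affine_mult g h = (fst g + snd g * fst h, snd g * snd h)"

definition affine_act :: "real \<times> real \<Rightarrow> real \<Rightarrow> real" where
  "affine_act g x = snd g * x + fst g"

abbreviation affine_borel :: "(real \<times> real) measure" where
  "affine_borel \<equiv> restrict_space borel affine_group"

abbreviation pos_borel :: "real measure" where
  "pos_borel \<equiv> restrict_space borel {0<..}"


definition measure_support :: "'a::topological_space measure \<Rightarrow> 'a set" where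
  "measure_support m =
    {g \<in> space m. \<forall>U. open U \<longrightarrow> g \<in> U \<longrightarrow> 0 < emeasure m (U \<inter> space m)}"

text \<open>Closedness is relative to \<open>G\<close>, which is not closed in the plane.\<close>

definition closed_subsemigroup :: "(real \<times> real) set \<Rightarrow> bool" where
  "closed_subsemigroup T \<longleftrightarrow>
    closedin (top_of_set affine_group) T \<and> (\<forall>g\<in>T. \<forall>h\<in>T. affine_mult g h \<in> T)"


definition mult_convolution :: "real measure \<Rightarrow> real measure \<Rightarrow> real measure" where
  "mult_convolution m n = distr (m \<Otimes>\<^sub>M n) pos_borel (\<lambda>(x, y). x * y)"

primrec mult_convolution_power :: "real measure \<Rightarrow> nat \<Rightarrow> real measure" where
  "mult_convolution_power m 0 = return pos_borel 1"
| "mult_convolution_power m (Suc n) = mult_convolution m (mult_convolution_power m n)"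

text \<open>The Haar measure \<open>dx / x\<close> of the multiplicative group \<open>\<real>\<^sup>+\<close>.\<close>

definition mult_haar :: "real measure" where
  "mult_haar = density (restrict_space lborel {0<..}) (\<lambda>x. ennreal (1 / x))"

text \<open>The measure \<open>m\<close> dominates a nonzero measure that is absolutely continuous with respect
  to \<open>h\<close>.\<close>

definition has_nonsingular_component :: "'a measure \<Rightarrow> 'a measure \<Rightarrow> bool" where
  "has_nonsingular_component h m \<longleftrightarrow>
    (\<exists>r. sets r = sets m \<and> (\<forall>E\<in>sets m. emeasure r E \<le> emeasure m E) \<and>
         absolutely_continuous h r \<and> emeasure r (space r) \<noteq> 0)"

definition spread_out :: "real measure \<Rightarrow> bool" where
  "spread_out m \<longleftrightarrow>
    (\<exists>n\<ge>1. has_nonsingular_component mult_haar (mult_convolution_power m n))"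


text \<open>On the real line, a Radon measure is a Borel measure that is finite on compact sets;
  regularity is then automatic.\<close>

definition radon_measure :: "real measure \<Rightarrow> bool" where
  "radon_measure \<nu> \<longleftrightarrow>
    sets \<nu> = sets borel \<and> (\<forall>K. compact K \<longrightarrow> emeasure \<nu> K < \<infinity>)"

definition invariant_radon_measure :: "(real \<times> real) measure \<Rightarrow> real measure \<Rightarrow> bool" where
  "invariant_radon_measure \<mu> \<nu> \<longleftrightarrow>
    radon_measure \<nu> \<and> emeasure \<nu> UNIV \<noteq> 0 \<and>
    (\<forall>f :: real \<Rightarrow> ennreal. f \<in> borel_measurable borel \<longrightarrow>
      (\<integral>\<^sup>+ g. (\<integral>\<^sup>+ x. f (affine_act g x) \<partial>\<nu>) \<partial>\<mu>) = (\<integral>\<^sup>+ x. f x \<partial>\<nu>))"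

definition ln_plus :: "real \<Rightarrow> real" where
  "ln_plus x = max 0 (ln x)"

end

theory Submission
  imports Defs
begin

text \<open>
  Let \<open>Y = A x + B\<close> be one step from \<open>x\<close>, distributed according to \<open>\<nu>\<close>. In the coordinate
  \<open>\<lambda>(x) = ln (1 + x\<^sup>+)\<close> a step is a centred random walk step \<open>\<xi> = ln A\<close> up to an error of order
  \<open>(ln \<bar>x\<bar>)\<^sup>-\<^sup>2\<close>. Testing invariance against \<open>(R - V)\<^sup>+\<close> with the Lyapunov function
  \<open>V = sqrt (1 + ln (1 + \<bar>x\<bar>))\<close> shows that \<open>\<nu>\<close> integrates \<open>(ln \<bar>x\<bar>)\<^sup>-\<^sup>3\<^sup>/\<^sup>2\<close>, so that these errors are
  integrable, and also that no mass flows to infinity: \<open>\<integral> E (h Y - h x) d\<nu> = 0\<close> for every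
  bounded \<open>h\<close> with integrable increment. For \<open>h = min \<lambda> t\<close> this identity says that
  \<open>\<integral> k (t - \<lambda> x) d\<nu>\<close> converges as \<open>t \<rightarrow> \<infinity>\<close>, where \<open>k\<close> is the integrable kernel with
  \<open>k'' = law \<xi> - \<delta>\<^sub>0\<close>.

  For a Lipschitz bump \<open>\<phi>\<close>, the function \<open>F t = \<integral> \<phi> (\<lambda> x - t) d\<nu>\<close> is therefore bounded and
  Lipschitz, and it is asymptotically harmonic for the walk. By a maximum principle in the style of
  Choquet and Deny it is asymptotically invariant under all translations, since the support of
  \<open>\<mu>\<close> generates the whole group. Hence \<open>F\<close> has the same limit as
  \<open>F * k / \<integral> k\<close>, an average of the convergent integrals above, and approximating indicators by bumps gives the theorem. The behaviour at
  \<open>- \<infinity>\<close> follows by reflection.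
\<close>

section \<open>Logarithmic coordinates\<close>

text \<open>The leading 1 keeps every value at least 1, so that its powers can serve as denominators
  at all points, including those near 0.\<close>

definition logsize :: "real \<Rightarrow> real" where
  "logsize x = 1 + ln (1 + \<bar>x\<bar>)"

text \<open>The size of the map \<open>x \<mapsto> a x + b\<close> on the logarithmic scale:
  \<open>cost a b - 1\<close> bounds the change of \<open>logsize\<close> in one step
  (\<open>logsize_diff\<close>). The summand 1 makes powers increase with the exponent.\<close>

definition cost :: "real \<Rightarrow> real \<Rightarrow> real" where
  "cost a b = 1 + \<bar>ln a\<bar> + ln (1 + \<bar>b\<bar>)"

text \<open>The coordinate for the behaviour at plus infinity. The left half-line is collapsed to 0,
  and for \<open>x > 0\<close> the value exceeds \<open>ln x\<close> by at most
  \<open>1 / x\<close>.\<close>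

definition poslog :: "real \<Rightarrow> real" where
  "poslog x = ln (1 + max 0 x)"

lemma logsize_ge_1 [simp]: "1 \<le> logsize x"
  by (simp add: logsize_def)

lemma logsize_pos [simp]: "0 < logsize x"
  using logsize_ge_1[of x] by linarith

lemma cost_ge_1 [simp]: "1 \<le> cost a b"
  by (simp add: cost_def)

lemma poslog_nonneg [simp]: "0 \<le> poslog x"
  by (simp add: poslog_def)

lemma poslog_nonpos [simp]: "x \<le> 0 \<Longrightarrow> poslog x = 0"
  by (simp add: poslog_def max_def)

lemma poslog_eq_logsize: "0 \<le> x \<Longrightarrow> poslog x = logsize x - 1"
  by (simp add: poslog_def logsize_def max_def)

lemma logsize_measurable [measurable]: "logsize \<in> borel_measurable borel"
  unfolding logsize_def[abs_def] by measurable

lemma poslog_measurable [measurable]: "poslog \<in> borel_measurable borel"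
  unfolding poslog_def[abs_def] by measurable

lemma exp_cost: "a > 0 \<Longrightarrow> exp (cost a b - 1) = exp \<bar>ln a\<bar> * (1 + \<bar>b\<bar>)"
  by (simp add: cost_def exp_add exp_ln_iff)

lemma exp_abs_ln_ge: 
  fixes a :: real
  assumes "a > 0" shows "a \<le> exp \<bar>ln a\<bar>" "1 / a \<le> exp \<bar>ln a\<bar>" "1 \<le> exp \<bar>ln a\<bar>"
proof -
  have "exp (ln a) \<le> exp \<bar>ln a\<bar>" unfolding exp_le_cancel_iff by simp
  moreover have "exp (- ln a) \<le> exp \<bar>ln a\<bar>" unfolding exp_le_cancel_iff by simp
  ultimately show "a \<le> exp \<bar>ln a\<bar>" "1 / a \<le> exp \<bar>ln a\<bar>" using assms by (simp_all add: exp_minus inverse_eq_divide)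
qed simp

section \<open>Error bounds for one step in logarithmic coordinates\<close>

lemma one_plus_affine_le:
  assumes "a > 0"
  shows "1 + \<bar>a * x + b\<bar> \<le> exp (cost a b - 1) * (1 + \<bar>x\<bar>)"
proof -
  let ?e = "exp \<bar>ln a\<bar>"
  have "\<bar>a * x + b\<bar> \<le> a * \<bar>x\<bar> + \<bar>b\<bar>" using assms abs_triangle_ineq[of "a*x" b] by (simp add: abs_mult)
  also have "\<dots> \<le> ?e * \<bar>x\<bar> + \<bar>b\<bar>" using exp_abs_ln_ge[OF assms] by (simp add: mult_right_mono)
  finally have "1 + \<bar>a * x + b\<bar> \<le> 1 + \<bar>b\<bar> + ?e * \<bar>x\<bar>" by simp
  also have "\<dots> \<le> ?e * (1 + \<bar>b\<bar>) + ?e * (1 + \<bar>b\<bar>) * \<bar>x\<bar>"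
  proof (rule add_mono)
    show "1 + \<bar>b\<bar> \<le> ?e * (1 + \<bar>b\<bar>)" using mult_right_mono[OF exp_abs_ln_ge(3)[OF assms], of "1 + \<bar>b\<bar>"] by simp
    show "?e * \<bar>x\<bar> \<le> ?e * (1 + \<bar>b\<bar>) * \<bar>x\<bar>" 
      by (intro mult_right_mono) (simp_all add: mult_le_cancel_left1)
  qed
  finally show ?thesis using assms by (simp add: exp_cost algebra_simps)
qed

text \<open>The inverse map is \<open>y \<mapsto> (y - b) / a\<close>, and
  \<open>exp \<bar>ln a\<bar>\<close> bounds \<open>1 / a\<close> as well as
  \<open>a\<close>.\<close>

lemma one_plus_le_affine:
  assumes "a > 0"
  shows "1 + \<bar>x\<bar> \<le> exp (cost a b - 1) * (1 + \<bar>a * x + b\<bar>)"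
proof -
  let ?e = "exp \<bar>ln a\<bar>" and ?y = "a * x + b"
  have "\<bar>x\<bar> = (1 / a) * \<bar>?y - b\<bar>" using assms by (simp add: abs_mult)
  also have "\<dots> \<le> ?e * (\<bar>?y\<bar> + \<bar>b\<bar>)" 
    using exp_abs_ln_ge[OF assms] assms by (intro mult_mono) auto
  finally have "1 + \<bar>x\<bar> \<le> ?e + ?e * (\<bar>?y\<bar> + \<bar>b\<bar>)" using exp_abs_ln_ge(3)[OF assms] by linarith
  then have "1 + \<bar>x\<bar> \<le> ?e * (1 + \<bar>?y\<bar> + \<bar>b\<bar>)" by (simp add: algebra_simps)
  also have "\<dots> \<le> ?e * ((1 + \<bar>b\<bar>) * (1 + \<bar>?y\<bar>))" by (intro mult_left_mono) (auto simp: algebra_simps)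
  finally show ?thesis using assms by (simp add: exp_cost algebra_simps)
qed

lemma ln_le_of_le_exp_mult: "\<lbrakk>0 < u; 0 < v; u \<le> exp c * v\<rbrakk> \<Longrightarrow> ln u \<le> c + ln (v::real)"
  by (metis exp_gt_zero ln_exp ln_le_cancel_iff ln_mult_pos mult_pos_pos)

lemma logsize_diff:
  assumes "a > 0" shows "\<bar>logsize (a * x + b) - logsize x\<bar> \<le> cost a b - 1"
  using ln_le_of_le_exp_mult[OF _ _ one_plus_affine_le[OF assms, of x b]]
    ln_le_of_le_exp_mult[OF _ _ one_plus_le_affine[OF assms, of x b]]
  by (simp add: logsize_def add_pos_nonneg)

text \<open>For starting points within reach of the step, \<open>w\<^sup>2 / S\<^sup>2\<close> is at
  least 1/16, so the trivial bound \<open>2 * w\<close> already has the required form.\<close>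

lemma bound_near:
  fixes e w S :: real
  assumes "e \<le> 2 * w" "S \<le> 4 * w" "0 < S" "1 \<le> w"
  shows "e \<le> 32 * w^3 / S\<^sup>2"
proof -
  have "e * S\<^sup>2 \<le> 2 * w * (4 * w)\<^sup>2" using assms by (intro mult_mono power_mono) auto
  also have "\<dots> = 32 * w^3" by (simp add: power2_eq_square power3_eq_cube)
  finally show ?thesis using assms by (simp add: field_simps)
qed

text \<open>Beyond \<open>S = 4 * w\<close> the exponent is at most \<open>- (S / 2)\<close>, and
  this exponential decay beats \<open>S\<^sup>2\<close>; up to there the trivial bound
  suffices.\<close>

lemma bound_far:
  fixes e w S :: real
  assumes "e \<le> 2 * w" "e \<le> exp (2 * (w - 1) - (S - 1))" "1 \<le> S" "1 \<le> w"
  shows "e \<le> 32 * w^3 / S\<^sup>2"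
proof (cases "S \<le> 4 * w")
  case True then show ?thesis using assms bound_near by simp
next
  case False
  have "(S/2)\<^sup>2/2 \<le> exp (S/2)" using assms exp_lower_Taylor_quadratic[of "S/2"] by simp
  then have 1: "S\<^sup>2 \<le> 8 * exp (S/2)" by (simp add: power2_eq_square field_simps)
  have "e \<le> exp (- (S/2))" using assms(2) False order_trans[of e "exp (2 * (w - 1) - (S - 1))" "exp (- (S/2))"] by simp
  then have "e * S\<^sup>2 \<le> exp (- (S/2)) * (8 * exp (S/2))" using 1 by (intro mult_mono) auto
  also have "\<dots> = 8" by (simp flip: exp_add)
  also have "\<dots> \<le> 32 * w^3" using one_le_power[OF assms(4), of 3] by simp
  finally show ?thesis using assms by (simp add: field_simps)
qed

lemma ln_ratio_le:
  assumes "0 < u" "0 < v" "u \<le> v + d" shows "ln u - ln v \<le> d / (v::real)"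
proof -
  have "ln u - ln v = ln (u / v)" using assms by (simp add: ln_div)
  also have "\<dots> \<le> u / v - 1" using assms by (intro ln_le_minus_one) auto
  also have "\<dots> \<le> (v + d) / v - 1" using assms by (intro diff_right_mono divide_right_mono) auto
  also have "\<dots> = d / v" using assms by (simp add: add_divide_distrib)
  finally show ?thesis .
qed

text \<open>The numbers \<open>1 + \<bar>a * x + b\<bar>\<close> and
  \<open>a * (1 + \<bar>x\<bar>)\<close> differ by an amount depending only on the map. Their
  logarithms therefore differ by a multiple of \<open>1 / (1 + \<bar>x\<bar>)\<close>, which is
  exponentially small in \<open>logsize x\<close>.\<close>

lemma logsize_defect:
  assumes "a > 0" 
  shows "\<bar>logsize (a * x + b) - logsize x - ln a\<bar> \<le> 32 * cost a b ^ 3 / (logsize x)\<^sup>2"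
proof (rule bound_far)
  let ?y = "a * x + b" and ?w = "cost a b" and ?e = "exp \<bar>ln a\<bar>"
  have "\<bar>ln a\<bar> \<le> ?w - 1" by (simp add: cost_def)
  then show "\<bar>logsize ?y - logsize x - ln a\<bar> \<le> 2 * ?w" using logsize_diff[OF assms, of x b] by linarith
  have e2: "exp (2 * (?w - 1)) = exp (?w - 1) * exp (?w - 1)" by (simp flip: exp_add)
  have R: "exp (2 * (?w - 1) - (logsize x - 1)) = exp (?w - 1) * exp (?w - 1) / (1 + \<bar>x\<bar>)"
    by (simp only: exp_diff[of _ "logsize x - 1"] e2) (simp add: logsize_def add_pos_nonneg)
  have E1: "1 \<le> exp (?w - 1)" by simp
  have ay: "\<bar>a * x\<bar> \<le> \<bar>?y\<bar> + \<bar>b\<bar>" "\<bar>?y\<bar> \<le> \<bar>a * x\<bar> + \<bar>b\<bar>" by linarith+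
  have "ln (1 + \<bar>?y\<bar>) - ln (a * (1 + \<bar>x\<bar>)) \<le> (1 + \<bar>b\<bar>) / (a * (1 + \<bar>x\<bar>))"
    using assms ay by (intro ln_ratio_le) (auto simp: abs_mult algebra_simps add_pos_nonneg intro!: mult_pos_pos)
  also have "\<dots> = (1 / a * (1 + \<bar>b\<bar>)) / (1 + \<bar>x\<bar>)" by simp
  also have "\<dots> \<le> exp (?w - 1) / (1 + \<bar>x\<bar>)"
    using exp_abs_ln_ge[OF assms] assms unfolding exp_cost[OF assms]
    by (intro divide_right_mono mult_right_mono) auto
  also have "\<dots> \<le> exp (?w - 1) * exp (?w - 1) / (1 + \<bar>x\<bar>)"
    using E1 by (intro divide_right_mono) (auto simp: mult_le_cancel_left1)
  finally have U: "logsize ?y - logsize x - ln a \<le> exp (2 * (?w - 1) - (logsize x - 1))"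
    using assms unfolding R by (simp add: logsize_def ln_mult_pos add_pos_nonneg)
  have "ln (a * (1 + \<bar>x\<bar>)) - ln (1 + \<bar>?y\<bar>) \<le> (a + \<bar>b\<bar>) / (1 + \<bar>?y\<bar>)"
    using assms ay by (intro ln_ratio_le) (auto simp: abs_mult algebra_simps add_pos_nonneg intro!: mult_pos_pos)
  also have "\<dots> \<le> exp (?w - 1) / (1 + \<bar>?y\<bar>)"
  proof (rule divide_right_mono)
    have "a + \<bar>b\<bar> \<le> ?e + ?e * \<bar>b\<bar>" using exp_abs_ln_ge[OF assms] by (intro add_mono) (auto simp: mult_le_cancel_right1)
    then show "a + \<bar>b\<bar> \<le> exp (?w - 1)" by (simp add: exp_cost[OF assms] algebra_simps)
  qed simp
  \<comment> \<open>Passing from the denominator at the arrival point to that at the starting point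
    costs a second factor \<open>exp (?w - 1)\<close>, hence the \<open>2 * (?w - 1)\<close> in the
    exponent.\<close>
  also have "\<dots> \<le> exp (?w - 1) * exp (?w - 1) / (1 + \<bar>x\<bar>)"
    using mult_left_mono[OF one_plus_le_affine[OF assms, of x b], of "exp (?w - 1)"]
    by (simp add: frac_le_eq divide_le_0_iff add_pos_nonneg mult.assoc)
  finally have L: "- (logsize ?y - logsize x - ln a) \<le> exp (2 * (?w - 1) - (logsize x - 1))"
    using assms unfolding R by (simp add: logsize_def ln_mult_pos add_pos_nonneg)
  show "\<bar>logsize ?y - logsize x - ln a\<bar> \<le> exp (2 * (?w - 1) - (logsize x - 1))"
    using U L by linarith
qed simp_all

text \<open>A step can cross 0 only if the translation overcomes the dilated starting point, which
  is then bounded in terms of the map.\<close>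

lemma logsize_le_cost_of_sign_change:
  assumes "a > 0" "x * (a * x + b) \<le> 0"
  shows "\<bar>x\<bar> * a \<le> \<bar>b\<bar>" "logsize x \<le> cost a b"
proof -
  show *: "\<bar>x\<bar> * a \<le> \<bar>b\<bar>" 
  proof (cases "x = 0")
    case False
    have "a * x\<^sup>2 \<le> - (x * b)" using assms(2) by (simp add: power2_eq_square algebra_simps)
    also have "\<dots> \<le> \<bar>x\<bar> * \<bar>b\<bar>" by (metis abs_ge_minus_self abs_mult)
    also have "a * x\<^sup>2 = \<bar>x\<bar> * (\<bar>x\<bar> * a)" by (simp add: power2_eq_square algebra_simps)
    finally show ?thesis using False by (simp add: mult_le_cancel_left_pos)
  qed simp
  have "\<bar>x\<bar> \<le> 1 / a * \<bar>b\<bar>" using * assms by (simp add: field_simps)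
  also have "\<dots> \<le> exp \<bar>ln a\<bar> * \<bar>b\<bar>" using exp_abs_ln_ge[OF assms(1)] by (intro mult_right_mono) auto
  finally have "1 + \<bar>x\<bar> \<le> exp \<bar>ln a\<bar> + exp \<bar>ln a\<bar> * \<bar>b\<bar>" 
    using exp_abs_ln_ge(3)[OF assms(1)] by linarith
  then have "1 + \<bar>x\<bar> \<le> exp (cost a b - 1) * 1"  by (simp add: exp_cost[OF assms(1)] algebra_simps)
  from ln_le_of_le_exp_mult[OF _ _ this] show "logsize x \<le> cost a b" by (simp add: logsize_def add_pos_nonneg)
qed

text \<open>If both points are positive this is \<open>logsize_defect\<close>; if neither is, the
  left side is 0. When the step crosses 0, the start is within reach of the map, and an error of
  size \<open>2 * cost a b\<close> is permitted by \<open>bound_near\<close>.\<close>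

lemma poslog_defect:
  assumes "a > 0"
  shows "\<bar>poslog (a * x + b) - (if x > 0 then poslog x + ln a else 0)\<bar> \<le> 32 * cost a b ^ 3 / (logsize x)\<^sup>2"
proof (cases "x > 0 \<and> a * x + b > 0")
  case True
  then show ?thesis using logsize_defect[OF assms, of x b] by (simp add: poslog_eq_logsize)
next
  case F: False
  show ?thesis
  proof (cases "x \<le> 0 \<and> a * x + b \<le> 0")
    case True then show ?thesis by (auto intro!: divide_nonneg_nonneg zero_le_power order_trans[OF zero_le_one cost_ge_1] order_trans[OF zero_le_one logsize_ge_1])
  next
    case False
    then have sc: "x * (a * x + b) \<le> 0" using F by (auto simp: mult_le_0_iff)
    note h = logsize_le_cost_of_sign_change[OF assms sc]
    show ?thesis
    proof (rule bound_near)
      have la: "\<bar>ln a\<bar> \<le> cost a b - 1" by (simp add: cost_def)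
      show "\<bar>poslog (a * x + b) - (if x > 0 then poslog x + ln a else 0)\<bar> \<le> 2 * cost a b"
      proof (cases "x > 0")
        case True
        then have "poslog (a * x + b) = 0" using F by simp
        moreover have "poslog x = logsize x - 1" using True by (simp add: poslog_eq_logsize)
        ultimately show ?thesis using h True la logsize_ge_1[of x] unfolding if_P[OF True] by linarith
      next
        case x: False
        then have y: "a * x + b > 0" using False by simp
        have "logsize (a * x + b) \<le> logsize x + (cost a b - 1)" using logsize_diff[OF assms, of x b] by linarith
        then have "poslog (a * x + b) \<le> 2 * cost a b" using h y by (simp add: poslog_eq_logsize)
        then show ?thesis using x by simp
      qed
      show "logsize x \<le> 4 * cost a b" using h cost_ge_1[of a b] by linarith
    qed simp_all
  qed
qed

section \<open>Expansion of the square-root Lyapunov function\<close>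

text \<open>With \<open>u = sqrt (1 + y)\<close> the gap between the two sides is
  \<open>(u - 1) ^ 4 * (u\<^sup>2 + 4 * u + 5) / 16\<close>, so the Taylor bound holds on the whole
  domain and not only for small \<open>y\<close>.\<close>

lemma sqrt_one_plus_le_cubic:
  assumes "- 1 \<le> y" shows "sqrt (1 + y) \<le> 1 + y / 2 - y\<^sup>2 / 8 + y ^ 3 / 16"
proof -
  define u where "u = sqrt (1 + y)"
  have u: "0 \<le> u" "y = u\<^sup>2 - 1" using assms by (simp_all add: u_def)
  have "0 \<le> (u - 1) ^ 4 * (u\<^sup>2 + 4 * u + 5)" using u by (intro mult_nonneg_nonneg) auto
  also have "\<dots> = 16 * ((1 + y / 2 - y\<^sup>2 / 8 + y ^ 3 / 16) - u)" 
    unfolding u(2) by (simp add: field_simps power2_eq_square power3_eq_cube power4_eq_xxxx)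
  finally show ?thesis by (simp add: u_def)
qed

text \<open>For centred \<open>ln a\<close> the linear term has mean zero. The mean increment is
  then governed by the quadratic term, which is negative because the square root is concave.\<close>

lemma sqrt_logsize_le:
  fixes x :: real
  assumes "a > 0" 
  defines "v \<equiv> sqrt (logsize x)"
  shows "sqrt (logsize (a * x + b)) \<le> v + ln a / (2 * v) - (ln a)\<^sup>2 / (8 * v ^ 3) + 25 * cost a b ^ 4 / v ^ 5"
proof -
  define w where "w = cost a b"
  define d where "d = logsize (a * x + b) - logsize x"
  define e where "e = d - ln a"
  have v: "1 \<le> v" "logsize x = v\<^sup>2" using order_less_imp_le[OF logsize_pos[of x]] by (simp_all only: v_def real_sqrt_ge_1_iff logsize_ge_1 real_sqrt_pow2)
  have w1: "1 \<le> w" by (simp add: w_def)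
  have d: "\<bar>d\<bar> \<le> w" using logsize_diff[OF assms(1), of x b] by (simp add: d_def w_def)
  have la: "\<bar>ln a\<bar> \<le> w" by (simp add: cost_def w_def)
  have e: "\<bar>e\<bar> \<le> 32 * w^3 / v^4" using logsize_defect[OF assms(1), of x b] v by (simp add: e_def d_def w_def)
  have "sqrt (logsize (a * x + b)) = sqrt (v\<^sup>2 * (1 + d / v\<^sup>2))" using v by (simp add: d_def field_simps)
  also have "\<dots> = v * sqrt (1 + d / v\<^sup>2)" using v by (simp add: real_sqrt_mult)
  also have "\<dots> \<le> v * (1 + (d / v\<^sup>2) / 2 - (d / v\<^sup>2)\<^sup>2 / 8 + (d / v\<^sup>2) ^ 3 / 16)"
  proof (intro mult_left_mono sqrt_one_plus_le_cubic)
    have "- (v\<^sup>2) \<le> d" using logsize_ge_1[of "a * x + b"] unfolding d_def v(2)[symmetric] by linarith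
    then show "- 1 \<le> d / v\<^sup>2" using v(1) by (simp add: field_simps)
  qed (use v in simp)
  also have "\<dots> = v + d / (2 * v) - d\<^sup>2 / (8 * v ^ 3) + d ^ 3 / (16 * v ^ 5)"
  proof -
    have "v * (d / v\<^sup>2 / 2) = d / (2 * v)" by (simp add: power2_eq_square)
    moreover have "v * ((d / v\<^sup>2)\<^sup>2 / 8) = d\<^sup>2 / (8 * v ^ 3)" using v(1) by (simp add: power2_eq_square power3_eq_cube)
    moreover have "v * ((d / v\<^sup>2) ^ 3 / 16) = d ^ 3 / (16 * v ^ 5)" using v(1) by (simp add: eval_nat_numeral)
    ultimately show ?thesis by (simp only: distrib_left right_diff_distrib mult_1_right)
  qed
  \<comment> \<open>Replacing \<open>d\<close> by \<open>ln a\<close> costs 16 in the linear term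
    and 8 in the quadratic one, and the cubic term costs 1; together this is the constant 25. In the
    quadratic term \<open>e\<^sup>2\<close> has the favourable sign and is dropped.\<close>
  also have "\<dots> \<le> v + (ln a / (2 * v) + 16 * w ^ 4 / v ^ 5) + (8 * w ^ 4 / v ^ 5 - (ln a)\<^sup>2 / (8 * v ^ 3)) + w ^ 4 / v ^ 5"
  proof -
    have "d / (2 * v) \<le> ln a / (2 * v) + 16 * w ^ 4 / v ^ 5"
    proof -
      have "e / (2 * v) \<le> (32 * w^3 / v^4) / (2 * v)" using e v by (intro divide_right_mono) auto
      also have "\<dots> = 16 * w ^ 3 / v ^ 5" using v(1) by (simp add: eval_nat_numeral)
      also have "\<dots> \<le> 16 * w ^ 4 / v ^ 5" using v w1 power_increasing[of 3 4 w] by (intro divide_right_mono) auto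
      finally show ?thesis by (simp add: e_def diff_divide_distrib)
    qed
    moreover have "- (d\<^sup>2 / (8 * v ^ 3)) \<le> 8 * w ^ 4 / v ^ 5 - (ln a)\<^sup>2 / (8 * v ^ 3)"
    proof -
      have "\<bar>ln a * e\<bar> \<le> w * (32 * w^3 / v^4)" unfolding abs_mult using la e w1 by (intro mult_mono) auto
      also have "\<dots> = 32 * w ^ 4 / v ^ 4" by (simp add: eval_nat_numeral)
      finally have 1: "\<bar>ln a * e\<bar> \<le> 32 * w ^ 4 / v ^ 4" .
      have "d\<^sup>2 = (ln a)\<^sup>2 + 2 * (ln a * e) + e\<^sup>2" by (simp add: e_def power2_eq_square algebra_simps)
      then have "(ln a)\<^sup>2 - d\<^sup>2 \<le> 2 * (32 * w ^ 4 / v ^ 4)" using 1 zero_le_power2[of e] by linarith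
      then have "((ln a)\<^sup>2 - d\<^sup>2) / (8 * v ^ 3) \<le> 2 * (32 * w ^ 4 / v ^ 4) / (8 * v ^ 3)" 
        using v by (intro divide_right_mono) auto
      also have "\<dots> = 8 * w ^ 4 / v ^ 7" using v(1) by (simp add: eval_nat_numeral)
      also have "\<dots> \<le> 8 * w ^ 4 / v ^ 5" using v w1 power_increasing[of 5 7 v] by (intro divide_left_mono) auto
      finally show ?thesis by (simp add: diff_divide_distrib)
    qed
    moreover have "d ^ 3 / (16 * v ^ 5) \<le> w ^ 4 / v ^ 5"
    proof -
      have "d ^ 3 \<le> \<bar>d\<bar> ^ 3" by (metis abs_ge_self power_abs)
      also have "\<dots> \<le> w ^ 3" using d by (intro power_mono) auto
      also have "\<dots> \<le> w ^ 4" using w1 by (intro power_increasing) auto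
      finally have "d ^ 3 / (16 * v ^ 5) \<le> w ^ 4 / (16 * v ^ 5)" using v by (intro divide_right_mono) auto
      also have "\<dots> \<le> w ^ 4 / v ^ 5" using v w1 by (intro divide_left_mono) auto
      finally show ?thesis .
    qed
    ultimately show ?thesis by linarith
  qed
  also have "\<dots> = v + ln a / (2 * v) - (ln a)\<^sup>2 / (8 * v ^ 3) + 25 * w ^ 4 / v ^ 5" by (simp add: diff_divide_distrib)
  finally show ?thesis by (simp add: w_def)
qed

section \<open>Asymptotically harmonic functions\<close>

text \<open>If \<open>g t = F (t - y) - F t\<close> had a positive upper limit \<open>m\<close>, then near-maximal points of \<open>g\<close>
  could be followed for arbitrarily many steps of size about \<open>y\<close>, each of which increases \<open>F\<close>
  by at least \<open>m / 2\<close>; this contradicts the boundedness of \<open>F\<close>.\<close>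

lemma (in prob_space) shift_limsup_le_0:
  fixes \<xi> :: "'a \<Rightarrow> real" and F :: "real \<Rightarrow> real"
  assumes [measurable]: "\<xi> \<in> borel_measurable M" "F \<in> borel_measurable borel"
    and bdd: "\<And>t. \<bar>F t\<bar> \<le> K"
    and lip: "\<And>s t. \<bar>F s - F t\<bar> \<le> l * \<bar>s - t\<bar>"
    and harm: "((\<lambda>t. F t - (\<integral>\<omega>. F (t - \<xi> \<omega>) \<partial>M)) \<longlongrightarrow> 0) at_top"
    and supp: "\<And>r. r > 0 \<Longrightarrow> 0 < prob {\<omega> \<in> space M. \<bar>\<xi> \<omega> - y\<bar> < r}"
    and "\<eta> > 0"
  shows "eventually (\<lambda>t. F (t - y) - F t \<le> \<eta>) at_top"
proof -
  define g where "g t = F (t - y) - F t" for t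
  have [measurable]: "g \<in> borel_measurable borel" unfolding g_def[abs_def] by measurable
  have l0: "0 \<le> l" using lip[of 1 0] by simp
  have K0: "0 \<le> K" using bdd[of 0] by linarith
  have gb: "\<bar>g t\<bar> \<le> 2 * K" for t using bdd[of t] bdd[of "t - y"] unfolding g_def by linarith
  have Fint: "integrable M (\<lambda>\<omega>. F (t - \<xi> \<omega>))" for t
    using bdd by (intro integrable_const_bound[where B=K]) auto
  have gint: "integrable M (\<lambda>\<omega>. g (t - \<xi> \<omega>))" for t
    using gb by (intro integrable_const_bound[where B="2*K"]) auto
  have gharm: "((\<lambda>t. g t - (\<integral>\<omega>. g (t - \<xi> \<omega>) \<partial>M)) \<longlongrightarrow> 0) at_top"
  proof -
    have sh: "filterlim (\<lambda>t::real. t - y) at_top at_top"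
      using filterlim_tendsto_add_at_top[OF tendsto_const[of "-y"] filterlim_ident] by (simp add: add.commute)
    have *: "((\<lambda>t. (F (t - y) - (\<integral>\<omega>. F (t - y - \<xi> \<omega>) \<partial>M)) - (F t - (\<integral>\<omega>. F (t - \<xi> \<omega>) \<partial>M))) \<longlongrightarrow> 0 - 0) at_top"
      by (intro tendsto_diff harm filterlim_compose[OF harm sh])
    have "(\<integral>\<omega>. g (t - \<xi> \<omega>) \<partial>M) = (\<integral>\<omega>. F (t - y - \<xi> \<omega>) \<partial>M) - (\<integral>\<omega>. F (t - \<xi> \<omega>) \<partial>M)" for t
      unfolding g_def using Fint[of t] Fint[of "t - y"] 
      by (subst Bochner_Integration.integral_diff[symmetric]) (auto simp: algebra_simps)
    then have "g t - (\<integral>\<omega>. g (t - \<xi> \<omega>) \<partial>M)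
      = (F (t - y) - (\<integral>\<omega>. F (t - y - \<xi> \<omega>) \<partial>M)) - (F t - (\<integral>\<omega>. F (t - \<xi> \<omega>) \<partial>M))" for t
      by (simp add: g_def)
    with * show ?thesis by simp
  qed
  \<comment> \<open>The infimum \<open>m\<close> of the eventual upper bounds is the upper limit of
    \<open>g\<close>; \<open>up\<close> and \<open>lo\<close> are its two characteristic
    properties.\<close>
  define S where "S = {c. eventually (\<lambda>t. g t \<le> c) at_top}"
  define m where "m = Inf S"
  have "2 * K \<in> S" using gb unfolding S_def by (auto simp: abs_le_iff)
  then have Sne: "S \<noteq> {}" by auto
  have Sbdd: "bdd_below S"
  proof (rule bdd_belowI[of _ "- 2 * K"])
    fix c assume "c \<in> S"
    then obtain t where "g t \<le> c" unfolding S_def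
      by (auto simp: eventually_at_top_linorder)
    then show "- 2 * K \<le> c" using gb[of t] by linarith
  qed
  have up: "eventually (\<lambda>t. g t \<le> m + \<epsilon>) at_top" if "\<epsilon> > 0" for \<epsilon>
  proof -
    obtain c where "c \<in> S" "c < m + \<epsilon>" using cInf_lessD[OF Sne, of "m + \<epsilon>"] \<open>\<epsilon> > 0\<close> unfolding m_def[symmetric] by auto
    then show ?thesis unfolding S_def by (auto elim: eventually_mono)
  qed
  have lo: "\<exists>t\<ge>T. m - \<epsilon> < g t" if "\<epsilon> > 0" for \<epsilon> T
  proof (rule ccontr)
    assume "\<not> ?thesis"
    then have "\<forall>t\<ge>T. g t \<le> m - \<epsilon>" by auto
    then have "m - \<epsilon> \<in> S" unfolding S_def eventually_at_top_linorder by blast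
    then have "m \<le> m - \<epsilon>" unfolding m_def using Sbdd cInf_lower by blast
    then show False using that by simp
  qed
  have "m \<le> 0"
  proof (rule ccontr)
    assume "\<not> m \<le> 0"
    then have m: "m > 0" by simp
    \<comment> \<open>With this radius, an inexact step loses at most \<open>m / 4\<close> of the
      value of \<open>F\<close>.\<close>
    define r where "r = m / (4 * (l + 1))"
    have r: "r > 0" "l * r \<le> m / 4" using m l0 by (auto simp: r_def field_simps)
    define U where "U = {\<omega> \<in> space M. \<bar>\<xi> \<omega> - y\<bar> < r}"
    define p where "p = prob U"
    have p: "0 < p" "p \<le> 1" using supp[OF r(1)] by (auto simp: p_def U_def)
    have [measurable]: "U \<in> sets M" unfolding U_def by measurable
    \<comment> \<open>If every step in \<open>U\<close> led below \<open>m - \<kappa>\<close>, the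
      mean would drop by at least \<open>4 * \<epsilon>\<close>. The quarter in the tolerance
      accounts for four errors of size \<open>\<epsilon>\<close>: the distance of \<open>g t\<close>
      from \<open>m\<close>, the excess of \<open>g\<close> over \<open>m\<close>, the tail below
      \<open>T1\<close>, and the failure of exact harmonicity.\<close>
    have step: "\<exists>T. \<forall>t\<ge>T. g t \<ge> m - p * \<kappa> / 4 \<longrightarrow> (\<exists>z. \<bar>z - y\<bar> < r \<and> m - \<kappa> \<le> g (t - z))" if "\<kappa> > 0" for \<kappa>
    proof -
      define \<epsilon> where "\<epsilon> = p * \<kappa> / 4"
      have e: "\<epsilon> > 0" using p that by (simp add: \<epsilon>_def)
      obtain T1 where T1: "\<And>t. t \<ge> T1 \<Longrightarrow> g t \<le> m + \<epsilon>" using up[OF e] unfolding eventually_at_top_linorder by auto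
      have "eventually (\<lambda>t. \<bar>g t - (\<integral>\<omega>. g (t - \<xi> \<omega>) \<partial>M)\<bar> < \<epsilon>) at_top"
        using tendstoD[OF gharm e] by (simp add: dist_real_def)
      then obtain T2 where T2: "\<And>t. t \<ge> T2 \<Longrightarrow> \<bar>g t - (\<integral>\<omega>. g (t - \<xi> \<omega>) \<partial>M)\<bar> < \<epsilon>"
        unfolding eventually_at_top_linorder by auto
      \<comment> \<open>Below \<open>T1\<close> only the crude bound \<open>2 * K\<close> on
        \<open>g\<close> is known, but the probability of landing there vanishes as \<open>t\<close>
        grows.\<close>
      have tail: "((\<lambda>t. \<integral>\<omega>. 2 * K * indicator {\<omega> \<in> space M. t - \<xi> \<omega> < T1} \<omega> \<partial>M) \<longlongrightarrow> (\<integral>\<omega>. 0 \<partial>M)) at_top"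
      proof (rule integral_dominated_convergence_at_top[where w="\<lambda>_. 2 * K"])
        show "AE \<omega> in M. ((\<lambda>t. 2 * K * indicator {\<omega> \<in> space M. t - \<xi> \<omega> < T1} \<omega>) \<longlongrightarrow> 0) at_top"
        proof (rule AE_I2)
          fix \<omega>
          have "eventually (\<lambda>t. 2 * K * indicator {\<omega> \<in> space M. t - \<xi> \<omega> < T1} \<omega> = (0::real)) at_top"
            using eventually_ge_at_top[of "T1 + \<xi> \<omega>"] by eventually_elim auto
          then show "((\<lambda>t. 2 * K * indicator {\<omega> \<in> space M. t - \<xi> \<omega> < T1} \<omega>) \<longlongrightarrow> (0::real)) at_top"
            by (rule tendsto_eventually)
        qed
      qed (use K0 in \<open>auto simp: indicator_def\<close>)
      then have "eventually (\<lambda>t. \<bar>\<integral>\<omega>. 2 * K * indicator {\<omega> \<in> space M. t - \<xi> \<omega> < T1} \<omega> \<partial>M\<bar> < \<epsilon>) at_top"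
        using tendstoD[OF tail e] by (simp add: dist_real_def)
      then obtain T3 where T3: "\<And>t. t \<ge> T3 \<Longrightarrow> \<bar>\<integral>\<omega>. 2 * K * indicator {\<omega> \<in> space M. t - \<xi> \<omega> < T1} \<omega> \<partial>M\<bar> < \<epsilon>"
        unfolding eventually_at_top_linorder by auto
      have "\<exists>z. \<bar>z - y\<bar> < r \<and> m - \<kappa> \<le> g (t - z)" if t: "t \<ge> max T2 T3" and gt: "g t \<ge> m - p * \<kappa> / 4" for t
      proof (rule ccontr)
        assume n: "\<not> ?thesis"
        have "(\<integral>\<omega>. g (t - \<xi> \<omega>) \<partial>M) \<le> (\<integral>\<omega>. (m + \<epsilon>) - (\<kappa> + \<epsilon>) * indicator U \<omega> + 2 * K * indicator {\<omega> \<in> space M. t - \<xi> \<omega> < T1} \<omega> \<partial>M)"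
        proof (rule integral_mono[OF gint])
          show "g (t - \<xi> \<omega>) \<le> (m + \<epsilon>) - (\<kappa> + \<epsilon>) * indicator U \<omega> + 2 * K * indicator {\<omega> \<in> space M. t - \<xi> \<omega> < T1} \<omega>"
            if w: "\<omega> \<in> space M" for \<omega>
          proof (cases "\<omega> \<in> U")
            case True
            then have "g (t - \<xi> \<omega>) < m - \<kappa>" using n w by (force simp: U_def)
            then show ?thesis using True K0 by (auto simp: indicator_def)
          next
            case False
            show ?thesis
            proof (cases "t - \<xi> \<omega> < T1")
              case True
              then show ?thesis using False w gb[of "t - \<xi> \<omega>"] e m by (auto simp: indicator_def)
            next
              case F: False
              then show ?thesis using T1[of "t - \<xi> \<omega>"] \<open>\<omega> \<notin> U\<close> by (auto simp: indicator_def)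
            qed
          qed
        qed (auto intro!: Bochner_Integration.integrable_add Bochner_Integration.integrable_diff integrable_mult_right integrable_real_indicator simp: less_top[symmetric])
        also have "\<dots> = (m + \<epsilon>) - (\<kappa> + \<epsilon>) * p + (\<integral>\<omega>. 2 * K * indicator {\<omega> \<in> space M. t - \<xi> \<omega> < T1} \<omega> \<partial>M)"
        proof -
          have U: "integrable M (\<lambda>\<omega>. (\<kappa> + \<epsilon>) * indicator U \<omega>)"
            and V: "integrable M (\<lambda>\<omega>. 2 * K * indicator {\<omega> \<in> space M. t - \<xi> \<omega> < T1} \<omega>)"
            by (auto intro!: integrable_mult_right integrable_real_indicator simp: less_top[symmetric])
          show ?thesis
            unfolding Bochner_Integration.integral_add[OF Bochner_Integration.integrable_diff[OF integrable_const U] V]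
              Bochner_Integration.integral_diff[OF integrable_const U]
            by (simp add: p_def prob_space)
        qed
        also have "\<dots> < (m + \<epsilon>) - (\<kappa> + \<epsilon>) * p + \<epsilon>" using T3[of t] t by linarith
        finally have "g t < m + 3 * \<epsilon> - (\<kappa> + \<epsilon>) * p" using T2[of t] t by linarith
        moreover have "(\<kappa> + \<epsilon>) * p \<ge> 4 * \<epsilon>" 
        proof -
          have "\<kappa> * p = 4 * \<epsilon>" by (simp add: \<epsilon>_def)
          then show ?thesis using mult_pos_pos[OF e p(1)] by (simp add: distrib_right)
        qed
        ultimately show False using gt by (simp add: \<epsilon>_def)
      qed
      then show ?thesis by blast
    qed
    \<comment> \<open>Tolerances are chosen backwards: ending within \<open>\<kappa>\<close> of
      \<open>m\<close> requires a smaller tolerance one step earlier. Hence \<open>\<kappa>\<close>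
      and \<open>T\<close> stay arbitrary in the induction.\<close>
    have claim: "\<exists>x\<ge>T. m - \<kappa> \<le> g x \<and> real n * (m / 2) - K \<le> F x" if "\<kappa> > 0" for n \<kappa> T
      using that
    proof (induction n arbitrary: \<kappa> T)
      case 0
      obtain x where "x \<ge> T" "m - \<kappa> < g x" using lo[OF 0] by blast
      then show ?case using bdd[of x] by (intro exI[of _ x]) auto
    next
      case (Suc n)
      obtain T1 where T1: "\<And>t. t \<ge> T1 \<Longrightarrow> g t \<ge> m - p * \<kappa> / 4 \<Longrightarrow> (\<exists>z. \<bar>z - y\<bar> < r \<and> m - \<kappa> \<le> g (t - z))"
        using step[OF Suc.prems] by blast
      \<comment> \<open>The first entry allows one more step. The second ensures a gain of at least
        \<open>m / 2\<close>: \<open>g x\<close> contributes \<open>m - m / 4\<close>, and the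
        inexactness of the step takes away at most \<open>m / 4\<close>.\<close>
      define \<kappa>' where "\<kappa>' = min (p * \<kappa> / 4) (m / 4)"
      have k': "\<kappa>' > 0" using p m Suc.prems by (simp add: \<kappa>'_def)
      obtain x where x: "x \<ge> max T1 (T + \<bar>y\<bar> + r)" "m - \<kappa>' \<le> g x" "real n * (m / 2) - K \<le> F x"
        using Suc.IH[OF k'] by blast
      obtain z where z: "\<bar>z - y\<bar> < r" "m - \<kappa> \<le> g (x - z)" using T1[of x] x by (force simp: \<kappa>'_def)
      have "F (x - z) \<ge> F (x - y) - l * r"
        using lip[of "x - y" "x - z"] mult_left_mono[OF order_less_imp_le[OF z(1)] l0] by simp
      also have "F (x - y) - l * r = F x + g x - l * r" by (simp add: g_def)
      finally have "F (x - z) \<ge> real n * (m / 2) - K + m / 2" using x r by (auto simp: \<kappa>'_def)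
      then have "real (Suc n) * (m / 2) - K \<le> F (x - z)" by (simp add: algebra_simps)
      moreover have "x - z \<ge> T" using x z by (auto simp: abs_if split: if_splits)
      ultimately show ?case using z by blast
    qed
    have "0 < m / 2" using m by simp
    from reals_Archimedean3[OF this] obtain n where n: "real n * (m / 2) > 2 * K" by blast
    obtain x where "real n * (m / 2) - K \<le> F x" using claim[of 1 0 n] by auto
    then show False using n bdd[of x] by linarith
  qed
  with up[OF \<open>\<eta> > 0\<close>] show ?thesis unfolding g_def by (auto elim!: eventually_mono)
qed

text \<open>The hypotheses are stable under replacing \<open>F\<close> by its negative, so the
  one-sided estimate applies in both directions.\<close>

lemma (in prob_space) shift_tendsto_0:
  fixes \<xi> :: "'a \<Rightarrow> real" and F :: "real \<Rightarrow> real"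
  assumes [measurable]: "\<xi> \<in> borel_measurable M" "F \<in> borel_measurable borel"
    and bdd: "\<And>t. \<bar>F t\<bar> \<le> K"
    and lip: "\<And>s t. \<bar>F s - F t\<bar> \<le> l * \<bar>s - t\<bar>"
    and harm: "((\<lambda>t. F t - (\<integral>\<omega>. F (t - \<xi> \<omega>) \<partial>M)) \<longlongrightarrow> 0) at_top"
    and supp: "\<And>r. r > 0 \<Longrightarrow> 0 < prob {\<omega> \<in> space M. \<bar>\<xi> \<omega> - y\<bar> < r}"
  shows "((\<lambda>t. F (t - y) - F t) \<longlongrightarrow> 0) at_top"
proof (rule tendstoI)
  fix e :: real assume "e > 0"
  then have e: "e / 2 > 0" by simp
  have 1: "eventually (\<lambda>t. F (t - y) - F t \<le> e / 2) at_top"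
    by (rule shift_limsup_le_0[OF assms e])
  have 2: "eventually (\<lambda>t. (- F (t - y)) - (- F t) \<le> e / 2) at_top"
  proof (rule shift_limsup_le_0[where F="\<lambda>t. - F t" and K=K and l=l and \<xi>=\<xi>])
    show "((\<lambda>t. - F t - (\<integral>\<omega>. - F (t - \<xi> \<omega>) \<partial>M)) \<longlongrightarrow> 0) at_top"
      using tendsto_minus[OF harm] by simp
    show "\<bar>- F s - - F t\<bar> \<le> l * \<bar>s - t\<bar>" for s t using lip[of s t] by linarith
  qed (use bdd supp e in auto)
  from 1 2 show "eventually (\<lambda>t. dist (F (t - y) - F t) 0 < e) at_top"
    by eventually_elim (use \<open>e > 0\<close> in \<open>auto simp: dist_real_def abs_less_iff\<close>)
qed

text \<open>By the Lipschitz bound the difference depends on the shift continuously, uniformly in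
  \<open>t\<close>; this gives closedness. Sums are handled by shifting in two stages.\<close>

lemma shift_all_tendsto_0:
  fixes F :: "real \<Rightarrow> real"
  assumes lip: "\<And>s t. \<bar>F s - F t\<bar> \<le> l * \<bar>s - t\<bar>"
  defines "H \<equiv> {y. ((\<lambda>t. F (t - y) - F t) \<longlongrightarrow> 0) at_top}"
  shows "closed H" "\<And>y z. y \<in> H \<Longrightarrow> z \<in> H \<Longrightarrow> y + z \<in> H"
proof -
  have l0: "0 \<le> l" using lip[of 1 0] by simp
  show "closed H"
  proof (unfold closed_sequential_limits, intro allI impI, elim conjE)
    fix f y assume f: "\<forall>n. f n \<in> H" and lim: "f \<longlonglongrightarrow> y"
    show "y \<in> H" unfolding H_def
    proof (intro CollectI tendstoI)
      fix e :: real assume e: "e > 0"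
      have "e / (2 * (l + 1)) > 0" using e l0 by simp
      then obtain n where n: "\<bar>f n - y\<bar> < e / (2 * (l + 1))"
        using lim unfolding lim_sequentially dist_real_def by blast
      have "l * \<bar>f n - y\<bar> \<le> (l + 1) * (e / (2 * (l + 1)))" using n l0 by (intro mult_mono) auto
      also have "\<dots> = e / 2" using l0 by (simp add: field_simps)
      finally have ln: "l * \<bar>f n - y\<bar> \<le> e / 2" .
      have "((\<lambda>t. F (t - f n) - F t) \<longlongrightarrow> 0) at_top" using f by (simp add: H_def)
      from tendstoD[OF this, of "e/2"] e show "eventually (\<lambda>t. dist (F (t - y) - F t) 0 < e) at_top"
      proof (simp add: dist_real_def, elim eventually_mono)
        fix t assume "\<bar>F (t - f n) - F t\<bar> * 2 < e"
        then show "\<bar>F (t - y) - F t\<bar> < e" proof -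
          have "\<bar>F (t - y) - F (t - f n)\<bar> \<le> e / 2" using lip[of "t - y" "t - f n"] ln by simp
          then show ?thesis using \<open>\<bar>F (t - f n) - F t\<bar> * 2 < e\<close> abs_triangle_ineq[of "F (t - y) - F (t - f n)" "F (t - f n) - F t"] by simp
        qed
      qed
    qed
  qed
  fix y z assume y: "y \<in> H" and z: "z \<in> H"
  have sh: "filterlim (\<lambda>t::real. t - y) at_top at_top"
    using filterlim_tendsto_add_at_top[OF tendsto_const[of "-y"] filterlim_ident] by (simp add: add.commute)
  have "((\<lambda>t. (F (t - y - z) - F (t - y)) + (F (t - y) - F t)) \<longlongrightarrow> 0 + 0) at_top"
    using y filterlim_compose[OF z[unfolded H_def mem_Collect_eq] sh] 
    by (intro tendsto_add) (auto simp: H_def)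
  then show "y + z \<in> H" by (simp add: H_def diff_diff_eq)
qed

section \<open>The invariant measure\<close>

text \<open>A Lipschitz substitute for the indicator of the interval from \<open>p\<close> to
  \<open>q\<close>; the ramps at both ends have width \<open>d\<close> and lie inside the
  interval.\<close>

definition trap :: "real \<Rightarrow> real \<Rightarrow> real \<Rightarrow> real \<Rightarrow> real" where
  "trap d p q v = max 0 (min 1 (min ((v - p) / d) ((q - v) / d)))"

lemma trap_bounds: "0 \<le> trap d p q v" "trap d p q v \<le> 1"
  by (auto simp: trap_def)

lemma trap_support: "0 < d \<Longrightarrow> trap d p q v \<noteq> 0 \<Longrightarrow> p < v \<and> v < q"
proof -
  assume d: "0 < d" and "trap d p q v \<noteq> 0"
  moreover have "trap d p q v = 0" if "min ((v - p) / d) ((q - v) / d) \<le> 0"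
    unfolding trap_def by (rule max_absorb1[OF min.coboundedI2[OF that]])
  ultimately have "\<not> min ((v - p) / d) ((q - v) / d) \<le> 0" by blast
  then have "0 < (v - p) / d" "0 < (q - v) / d" by (simp_all add: not_le)
  then show "p < v \<and> v < q" using d by (simp add: zero_less_divide_iff)
qed

lemma trap_eq_1: "0 < d \<Longrightarrow> p + d \<le> v \<Longrightarrow> v \<le> q - d \<Longrightarrow> trap d p q v = 1"
  by (auto simp: trap_def max_def min_def field_simps)

lemma trap_lipschitz: "0 < d \<Longrightarrow> \<bar>trap d p q s - trap d p q t\<bar> \<le> (1 / d) * \<bar>s - t\<bar>"
proof -
  assume d: "0 < d"
  have nonexp: "\<bar>max 0 (min 1 x) - max 0 (min 1 y)\<bar> \<le> \<bar>x - y\<bar>" for x y :: real by (auto simp: max_def min_def)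
  have min2: "\<bar>min x y - min x' y'\<bar> \<le> e" if "\<bar>x - x'\<bar> \<le> e" "\<bar>y - y'\<bar> \<le> e" for x y x' y' e :: real
    using that by (auto simp: min_def)
  have "\<bar>trap d p q s - trap d p q t\<bar> \<le> \<bar>min ((s - p) / d) ((q - s) / d) - min ((t - p) / d) ((q - t) / d)\<bar>"
    unfolding trap_def by (rule nonexp)
  also have "\<dots> \<le> \<bar>s - t\<bar> / d"
    using d by (intro min2) (simp_all add: diff_divide_distrib[symmetric] abs_minus_commute)
  finally show ?thesis by simp
qed

lemma trap_measurable [measurable]: "trap d p q \<in> borel_measurable borel"
  unfolding trap_def[abs_def] by measurable

lemma trap_integral:
  assumes "0 < d"
  shows "p \<le> q \<Longrightarrow> (\<integral>v. trap d p q v \<partial>lborel) \<le> q - p" and "q - p - 2 * d \<le> (\<integral>v. trap d p q v \<partial>lborel)"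
proof -
  have up: "trap d p q v \<le> indicator {p..q} v" for v
    using trap_support[OF assms(1), of p q v] trap_bounds[of d p q v] 
    by (cases "trap d p q v = 0") (auto simp: indicator_def)
  have lo: "indicator {p + d..q - d} v \<le> trap d p q v" for v
    using trap_eq_1[OF assms(1), of p v q] trap_bounds[of d p q v] by (auto simp: indicator_def)
  have ind: "integrable lborel (\<lambda>v. indicator {p..q} v :: real)"
    by (intro integrable_real_indicator) (auto simp: emeasure_lborel_Icc_eq)
  have int: "integrable lborel (trap d p q)"
    by (rule Bochner_Integration.integrable_bound[OF ind]) (use up trap_bounds in \<open>auto intro!: AE_I2\<close>)
  have "(\<integral>v. trap d p q v \<partial>lborel) \<le> (\<integral>v. indicator {p..q} v \<partial>lborel)" by (intro integral_mono int ind up)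
  then show "p \<le> q \<Longrightarrow> (\<integral>v. trap d p q v \<partial>lborel) \<le> q - p" by simp
  show "q - p - 2 * d \<le> (\<integral>v. trap d p q v \<partial>lborel)"
  proof (cases "p + d \<le> q - d")
    case True
    have "(\<integral>v. indicator {p + d..q - d} v \<partial>lborel) \<le> (\<integral>v. trap d p q v \<partial>lborel)" 
      by (intro integral_mono int lo integrable_real_indicator) (auto simp: emeasure_lborel_Icc_eq)
    then show ?thesis using True by simp
  next
    case False
    have "0 \<le> (\<integral>v. trap d p q v \<partial>lborel)" by (intro Bochner_Integration.integral_nonneg trap_bounds)
    then show ?thesis using False by simp
  qed
qed

lemma sigma_finite_if_finite_on_compact:
  fixes m :: "real measure"
  assumes "sets m = sets borel" "\<And>K. compact K \<Longrightarrow> emeasure m K < \<infinity>"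
  shows "sigma_finite_measure m"
proof
  show "\<exists>X. countable X \<and> X \<subseteq> sets m \<and> \<Union>X = space m \<and> (\<forall>a\<in>X. emeasure m a \<noteq> \<infinity>)"
  proof (intro exI[of _ "range (\<lambda>n::nat. {- real n..real n})"] conjI ballI)
    show "\<Union> (range (\<lambda>n::nat. {- real n..real n})) = space m"
    proof -
      have "\<exists>n::nat. - real n \<le> x \<and> x \<le> real n" for x :: real
        using real_arch_simple[of "\<bar>x\<bar>"] by (metis abs_le_iff minus_le_iff)
      then show ?thesis using sets_eq_imp_space_eq[OF assms(1)] by (auto simp: set_eq_iff)
    qed
    show "emeasure m a \<noteq> \<infinity>" if "a \<in> range (\<lambda>n::nat. {- real n..real n})" for a
      using that assms(2)[of a] by (auto simp: less_top)
  qed (auto simp: assms(1))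
qed

section \<open>Random affine maps with an invariant measure\<close>

text \<open>\<open>A\<close> is positive on the whole type, so that no restriction to
  \<open>space M\<close> has to be carried along. The assumption \<open>aperiodic\<close> is the
  trace of the group hypothesis on dilations: a closed additive set containing the support of the
  law of \<open>ln A\<close> is the whole line.\<close>

locale critical_affine_recursion = prob_space M for M :: "'w measure" +
  fixes A B :: "'w \<Rightarrow> real" and \<nu> :: "real measure"
  assumes A_measurable [measurable]: "A \<in> borel_measurable M"
    and B_measurable [measurable]: "B \<in> borel_measurable M"
    and A_pos [simp]: "0 < A \<omega>"
    and cost_integrable: "integrable M (\<lambda>\<omega>. cost (A \<omega>) (B \<omega>) ^ 4)"
    and centered: "expectation (\<lambda>\<omega>. ln (A \<omega>)) = 0"
    and nondegenerate: "0 < expectation (\<lambda>\<omega>. (ln (A \<omega>))\<^sup>2)"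
    and aperiodic: "\<lbrakk>closed H; \<And>y z. \<lbrakk>y \<in> H; z \<in> H\<rbrakk> \<Longrightarrow> y + z \<in> H;
      \<And>y. (\<And>r. 0 < r \<Longrightarrow> 0 < prob {\<omega> \<in> space M. \<bar>ln (A \<omega>) - y\<bar> < r}) \<Longrightarrow> y \<in> H\<rbrakk> \<Longrightarrow> H = UNIV"
    and sets_nu [measurable_cong]: "sets \<nu> = sets borel"
    and finite_on_compact: "compact K \<Longrightarrow> emeasure \<nu> K < \<infinity>"
    and invariant: "f \<in> borel_measurable borel \<Longrightarrow>
      (\<integral>\<^sup>+ \<omega>. (\<integral>\<^sup>+ x. f (A \<omega> * x + B \<omega>) \<partial>\<nu>) \<partial>M) = (\<integral>\<^sup>+ x. f x \<partial>\<nu>)"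
begin

abbreviation \<xi> :: "'w \<Rightarrow> real" where "\<xi> \<omega> \<equiv> ln (A \<omega>)"
abbreviation w :: "'w \<Rightarrow> real" where "w \<omega> \<equiv> cost (A \<omega>) (B \<omega>)"
abbreviation Q :: "('w \<times> real) measure" where "Q \<equiv> M \<Otimes>\<^sub>M \<nu>"
abbreviation Y :: "'w \<times> real \<Rightarrow> real" where "Y p \<equiv> A (fst p) * snd p + B (fst p)"

lemma space_nu [simp]: "space \<nu> = UNIV"
  using sets_eq_imp_space_eq[OF sets_nu] by simp

sublocale nu: sigma_finite_measure \<nu>
  by (rule sigma_finite_if_finite_on_compact[OF sets_nu finite_on_compact])

sublocale pair_sigma_finite M \<nu> ..

lemma w_measurable [measurable]: "w \<in> borel_measurable M"
  unfolding cost_def by measurable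

lemma w_power_integrable: "n \<le> 4 \<Longrightarrow> integrable M (\<lambda>\<omega>. w \<omega> ^ n)"
  by (rule Bochner_Integration.integrable_bound[OF cost_integrable])
     (auto intro!: AE_I2 power_increasing power_mono simp: abs_of_nonneg order_trans[OF zero_le_one cost_ge_1])

lemma abs_xi_le: "1 + \<bar>\<xi> \<omega>\<bar> \<le> w \<omega>"
  by (simp add: cost_def)

lemma xi_integrable: "integrable M \<xi>"
proof (rule Bochner_Integration.integrable_bound[OF w_power_integrable[of 1]])
  show "AE x in M. norm (\<xi> x) \<le> norm (w x ^ 1)"
    using abs_xi_le by (intro AE_I2) (smt (verit) power_one_right real_norm_def)
qed simp_all

lemma xi_sq_integrable: "integrable M (\<lambda>\<omega>. (\<xi> \<omega>)\<^sup>2)"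
proof (rule Bochner_Integration.integrable_bound[OF w_power_integrable[of 2]])
  show "AE x in M. norm ((\<xi> x)\<^sup>2) \<le> norm (w x ^ 2)"
    using abs_xi_le by (intro AE_I2) (smt (verit) real_norm_def norm_power power_mono)
qed simp_all

lemma finite_on_bounded:
  assumes "S \<in> sets borel" "\<And>x. x \<in> S \<Longrightarrow> \<bar>x\<bar> \<le> c"
  shows "S \<in> fmeasurable \<nu>"
proof (rule fmeasurableI)
  have "emeasure \<nu> S \<le> emeasure \<nu> {-c..c}" using assms(2) by (intro emeasure_mono) (force simp: sets_nu abs_le_iff)+
  also have "\<dots> < \<infinity>" by (intro finite_on_compact) simp
  finally show "emeasure \<nu> S < \<infinity>" .
qed (use assms sets_nu in simp)

lemma integrable_bounded_support:
  fixes f :: "real \<Rightarrow> real"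
  assumes [measurable]: "f \<in> borel_measurable borel" and "\<And>x. \<bar>f x\<bar> \<le> c" "\<And>x. f x \<noteq> 0 \<Longrightarrow> \<bar>x\<bar> \<le> r"
  shows "integrable \<nu> f"
proof (rule Bochner_Integration.integrable_bound)
  show "integrable \<nu> (\<lambda>x. c * indicator {-r..r} x)"
    using finite_on_compact[of "{-r..r}"] by (intro integrable_mult_right integrable_real_indicator) (auto simp: sets_nu)
  show "AE x in \<nu>. norm (f x) \<le> norm (c * indicator {- r..r} x)"
  proof (rule AE_I2)
    fix x show "norm (f x) \<le> norm (c * indicator {- r..r} x)"
      using assms(2)[of x] assms(3)[of x] by (cases "f x = 0") (auto simp: indicator_def abs_le_iff)
  qed
qed simp

text \<open>Written as an equality of image measures, invariance also applies to integrals of signed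
  functions, through change of variables.\<close>

lemma distr_Y: "distr Q borel Y = \<nu>"
proof (rule measure_eqI)
  fix S assume "S \<in> sets (distr Q borel Y)"
  then have [measurable]: "S \<in> sets borel" by simp
  have "emeasure (distr Q borel Y) S = (\<integral>\<^sup>+ x. indicator S x \<partial>distr Q borel Y)" by simp
  also have "\<dots> = (\<integral>\<^sup>+ p. indicator S (Y p) \<partial>Q)" by (subst nn_integral_distr) auto
  also have "\<dots> = (\<integral>\<^sup>+ \<omega>. (\<integral>\<^sup>+ x. indicator S (A \<omega> * x + B \<omega>) \<partial>\<nu>) \<partial>M)"
    by (subst nu.nn_integral_fst[symmetric]) auto
  also have "\<dots> = emeasure \<nu> S" using invariant[of "indicator S"] by (simp add: sets_nu)
  finally show "emeasure (distr Q borel Y) S = emeasure \<nu> S" .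
qed (simp add: sets_nu)

lemma distr_snd: "distr Q borel snd = \<nu>"
proof (rule measure_eqI)
  fix S assume "S \<in> sets (distr Q borel snd)"
  then have [measurable]: "S \<in> sets borel" by simp
  have "emeasure (distr Q borel snd) S = (\<integral>\<^sup>+ x. indicator S x \<partial>distr Q borel snd)" by simp
  also have "\<dots> = (\<integral>\<^sup>+ p. indicator S (snd p) \<partial>Q)" by (subst nn_integral_distr) auto
  also have "\<dots> = (\<integral>\<^sup>+ \<omega>. (\<integral>\<^sup>+ x. indicator S x \<partial>\<nu>) \<partial>M)"
    by (subst nu.nn_integral_fst[symmetric]) auto
  also have "\<dots> = emeasure \<nu> S" by (simp add: sets_nu emeasure_space_1)
  finally show "emeasure (distr Q borel snd) S = emeasure \<nu> S" .
qed (simp add: sets_nu)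

lemma
  fixes f :: "real \<Rightarrow> real"
  assumes f: "integrable \<nu> f"
  shows integrable_Y: "integrable Q (\<lambda>p. f (Y p))"
    and integrable_snd_fun: "integrable Q (\<lambda>p. f (snd p))"
    and integral_Y: "(\<integral>p. f (Y p) \<partial>Q) = (\<integral>x. f x \<partial>\<nu>)"
    and integral_snd_fun: "(\<integral>p. f (snd p) \<partial>Q) = (\<integral>x. f x \<partial>\<nu>)"
proof -
  have [measurable]: "f \<in> borel_measurable borel" using borel_measurable_integrable[OF f] by simp
  show "integrable Q (\<lambda>p. f (Y p))" using f integrable_distr_eq[of Y Q borel f] by (simp add: distr_Y)
  show "integrable Q (\<lambda>p. f (snd p))" using f integrable_distr_eq[of snd Q borel f] by (simp add: distr_snd)
  show "(\<integral>p. f (Y p) \<partial>Q) = (\<integral>x. f x \<partial>\<nu>)" using integral_distr[of Y Q borel f] by (simp add: distr_Y)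
  show "(\<integral>p. f (snd p) \<partial>Q) = (\<integral>x. f x \<partial>\<nu>)" using integral_distr[of snd Q borel f] by (simp add: distr_snd)
qed

text \<open>Integrability of \<open>f\<close> is what permits splitting the difference.
  \<open>flux_zero\<close> extends the identity to bounded functions of which only the increment is
  integrable.\<close>

lemma integral_increment:
  fixes f :: "real \<Rightarrow> real"
  assumes f: "integrable \<nu> f"
  shows "integrable Q (\<lambda>p. f (Y p) - f (snd p))" "(\<integral>p. f (Y p) - f (snd p) \<partial>Q) = 0"
  using integrable_Y[OF f] integrable_snd_fun[OF f] integral_Y[OF f] integral_snd_fun[OF f] by auto

lemma integrable_product:
  fixes u :: "'w \<Rightarrow> real" and f :: "real \<Rightarrow> real"
  assumes u: "integrable M u" and f: "integrable \<nu> f"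
  shows "integrable Q (\<lambda>p. u (fst p) * f (snd p))"
proof (rule Fubini_integrable)
  have [measurable]: "u \<in> borel_measurable M" "f \<in> borel_measurable borel" 
    using borel_measurable_integrable[OF f] u by auto
  show "(\<lambda>p. u (fst p) * f (snd p)) \<in> borel_measurable Q" by measurable
  show "integrable M (\<lambda>x. \<integral>y. norm (u (fst (x, y)) * f (snd (x, y))) \<partial>\<nu>)"
    using u by (simp add: abs_mult)
  show "AE x in M. integrable \<nu> (\<lambda>y. u (fst (x, y)) * f (snd (x, y)))" using f by simp
qed

section \<open>Lyapunov drift and the tail of the invariant measure\<close>

definition lyap :: "real \<Rightarrow> real" where "lyap x = sqrt (logsize x)"

lemma lyap_measurable [measurable]: "lyap \<in> borel_measurable borel"
  unfolding lyap_def[abs_def] by measurable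

lemma lyap_ge_1: "1 \<le> lyap x" and lyap_sq: "(lyap x)\<^sup>2 = logsize x"
  by (simp_all add: lyap_def order_less_imp_le[OF logsize_pos])

lemma lyap_step: "lyap (A \<omega> * x + B \<omega>) \<le> lyap x + \<xi> \<omega> / (2 * lyap x) - (\<xi> \<omega>)\<^sup>2 / (8 * lyap x ^ 3) + 25 * w \<omega> ^ 4 / lyap x ^ 5"
  unfolding lyap_def by (rule sqrt_logsize_le) simp

lemma abs_le_of_lyap_le: "lyap x \<le> R \<Longrightarrow> \<bar>x\<bar> \<le> exp (R\<^sup>2)"
proof -
  assume "lyap x \<le> R"
  then have "logsize x \<le> R\<^sup>2" using power_mono[of "lyap x" R 2] lyap_ge_1[of x] lyap_sq[of x] by simp
  then have "ln (1 + \<bar>x\<bar>) \<le> R\<^sup>2" by (simp add: logsize_def)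
  then have "1 + \<bar>x\<bar> \<le> exp (R\<^sup>2)" by (metis abs_ge_zero add_pos_nonneg exp_le_cancel_iff exp_ln zero_less_one)
  then show ?thesis by simp
qed

definition \<sigma>2 :: real where "\<sigma>2 = expectation (\<lambda>\<omega>. (\<xi> \<omega>)\<^sup>2)"
definition m4 :: real where "m4 = expectation (\<lambda>\<omega>. w \<omega> ^ 4)"

text \<open>Outside this set half of the quadratic gain, \<open>\<sigma>2 / (16 * v ^ 3)\<close>,
  dominates the error \<open>25 * m4 / v ^ 5\<close>, where \<open>v\<^sup>2 = logsize x\<close>;
  hence \<open>400 = 16 * 25\<close>.\<close>

definition core :: "real set" where "core = {x. logsize x \<le> 400 * m4 / \<sigma>2}"

lemma core_measurable [measurable]: "core \<in> sets borel"
  unfolding core_def by measurable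

lemma \<sigma>2_pos: "0 < \<sigma>2" using nondegenerate by (simp add: \<sigma>2_def)
lemma m4_nonneg: "0 \<le> m4" unfolding m4_def by (intro Bochner_Integration.integral_nonneg) simp

lemma core_finite: "core \<in> fmeasurable \<nu>"
proof (rule finite_on_bounded)
  fix x assume "x \<in> core"
  then have "lyap x \<le> sqrt (400 * m4 / \<sigma>2)" by (simp add: core_def lyap_def)
  then show "\<bar>x\<bar> \<le> exp ((sqrt (400 * m4 / \<sigma>2))\<^sup>2)" by (rule abs_le_of_lyap_le)
qed simp

lemma lyap_step_integrable: "integrable M (\<lambda>\<omega>. lyap (A \<omega> * x + B \<omega>))"
proof (rule Bochner_Integration.integrable_bound)
  show "integrable M (\<lambda>\<omega>. logsize x + w \<omega> ^ 1)"
    using w_power_integrable[of 1] by simp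
  show "AE \<omega> in M. norm (lyap (A \<omega> * x + B \<omega>)) \<le> norm (logsize x + w \<omega> ^ 1)"
  proof (rule AE_I2)
    fix \<omega>
    have "lyap (A \<omega> * x + B \<omega>) \<le> (lyap (A \<omega> * x + B \<omega>))\<^sup>2" using lyap_ge_1[of "A \<omega> * x + B \<omega>"] by (simp add: power2_eq_square)
    also have "\<dots> \<le> logsize x + w \<omega>" using logsize_diff[of "A \<omega>" x "B \<omega>"] by (simp add: lyap_sq)
    finally show "norm (lyap (A \<omega> * x + B \<omega>)) \<le> norm (logsize x + w \<omega> ^ 1)"
      using lyap_ge_1[of "A \<omega> * x + B \<omega>"] by simp
  qed
qed simp

text \<open>Centring removes the linear term of \<open>lyap_step\<close>. Outside
  \<open>core\<close> half of the quadratic gain absorbs the error term; on \<open>core\<close> that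
  error is at most \<open>25 * m4\<close>, since \<open>lyap\<close> is at least 1.\<close>

lemma drift: "expectation (\<lambda>\<omega>. lyap (A \<omega> * x + B \<omega>)) \<le> lyap x - \<sigma>2 / (16 * lyap x ^ 3) + 25 * m4 * indicator core x"
proof -
  define v where "v = lyap x"
  have v: "1 \<le> v" using lyap_ge_1 by (simp add: v_def)
  have "expectation (\<lambda>\<omega>. lyap (A \<omega> * x + B \<omega>)) \<le> expectation (\<lambda>\<omega>. v + \<xi> \<omega> / (2 * v) - (\<xi> \<omega>)\<^sup>2 / (8 * v ^ 3) + 25 * w \<omega> ^ 4 / v ^ 5)"
    using xi_integrable xi_sq_integrable w_power_integrable[of 4] lyap_step[of _ x]
    by (intro integral_mono lyap_step_integrable) (auto simp: v_def)
  also have "\<dots> = v - \<sigma>2 / (8 * v ^ 3) + 25 * m4 / v ^ 5"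
    using xi_integrable xi_sq_integrable w_power_integrable[of 4] by (simp add: centered prob_space \<sigma>2_def m4_def)
  also have "\<dots> \<le> v - \<sigma>2 / (16 * v ^ 3) + 25 * m4 * indicator core x"
  proof (cases "x \<in> core")
    case True
    have "\<sigma>2 / (16 * v ^ 3) \<le> \<sigma>2 / (8 * v ^ 3)" using v \<sigma>2_pos by (intro divide_left_mono) auto
    moreover have "25 * m4 / v ^ 5 \<le> 25 * m4 / 1" using v m4_nonneg by (intro divide_left_mono) auto
    ultimately show ?thesis using True by simp
  next
    case False
    then have "400 * m4 \<le> \<sigma>2 * v\<^sup>2" using \<sigma>2_pos lyap_sq[of x] by (simp add: core_def v_def field_simps)
    then have "400 * m4 / (16 * v ^ 5) \<le> (\<sigma>2 * v\<^sup>2) / (16 * v ^ 5)" using v by (intro divide_right_mono) auto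
    also have "\<dots> = \<sigma>2 / (16 * v ^ 3)" using v by (simp add: eval_nat_numeral)
    finally have "25 * m4 / v ^ 5 \<le> \<sigma>2 / (16 * v ^ 3)" by simp
    moreover have "\<sigma>2 / (8 * v ^ 3) = 2 * (\<sigma>2 / (16 * v ^ 3))" by simp
    ultimately show ?thesis using False by simp
  qed
  finally show ?thesis by (simp add: v_def)
qed

text \<open>Truncating \<open>R - lyap\<close> at 0 gives a bounded function of bounded support, to
  which invariance can be applied.\<close>

definition tent :: "real \<Rightarrow> real \<Rightarrow> real" where "tent R x = max 0 (R - lyap x)"

lemma tent_measurable [measurable]: "tent R \<in> borel_measurable borel"
  unfolding tent_def[abs_def] by measurable

lemma tent_bounds: "0 \<le> tent R x" "0 \<le> R \<Longrightarrow> tent R x \<le> R"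
  using lyap_ge_1[of x] by (auto simp: tent_def)

lemma tent_support: "tent R x \<noteq> 0 \<Longrightarrow> \<bar>x\<bar> \<le> exp (R\<^sup>2)"
  by (rule abs_le_of_lyap_le) (simp add: tent_def max_def split: if_splits)

lemma tent_integrable: "0 \<le> R \<Longrightarrow> integrable \<nu> (tent R)"
  by (rule integrable_bounded_support[where c=R and r="exp (R\<^sup>2)"]) (use tent_bounds tent_support in auto)

definition tent_drift :: "real \<Rightarrow> real \<Rightarrow> real" where
  "tent_drift R x = expectation (\<lambda>\<omega>. tent R (A \<omega> * x + B \<omega>)) - tent R x"

lemma tent_step_integrable: "0 \<le> R \<Longrightarrow> integrable M (\<lambda>\<omega>. tent R (A \<omega> * x + B \<omega>))"
  using tent_bounds by (intro integrable_const_bound[where B=R]) auto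

lemma tent_drift_integral:
  assumes "0 \<le> R" shows "integrable \<nu> (tent_drift R)" "(\<integral>x. tent_drift R x \<partial>\<nu>) = 0"
proof -
  have eq: "(\<integral>\<omega>. tent R (Y (\<omega>, x)) - tent R (snd (\<omega>, x)) \<partial>M) = tent_drift R x" for x
    using tent_step_integrable[OF assms, of x] by (simp add: tent_drift_def prob_space)
  have int: "integrable Q (\<lambda>(\<omega>, x). tent R (Y (\<omega>, x)) - tent R (snd (\<omega>, x)))"
    using integral_increment(1)[OF tent_integrable[OF assms]] by (simp add: case_prod_beta')
  from integrable_snd[OF int] show "integrable \<nu> (tent_drift R)" unfolding eq by simp
  from integral_snd[OF int] show "(\<integral>x. tent_drift R x \<partial>\<nu>) = 0" 
    unfolding eq using integral_increment(2)[OF tent_integrable[OF assms]] by (simp add: case_prod_beta')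
qed

text \<open>Where \<open>lyap x \<le> R\<close>, the truncation can only raise the expectation, so
  \<open>drift\<close> applies with reversed sign. Elsewhere the tent starts at its minimum 0 and
  cannot decrease.\<close>

lemma tent_drift_ge:
  assumes "0 \<le> R"
  shows "indicator {x. lyap x \<le> R} x * (\<sigma>2 / (16 * lyap x ^ 3)) - 25 * m4 * indicator core x \<le> tent_drift R x"
proof (cases "lyap x \<le> R")
  case True
  have "R - expectation (\<lambda>\<omega>. lyap (A \<omega> * x + B \<omega>)) = expectation (\<lambda>\<omega>. R - lyap (A \<omega> * x + B \<omega>))"
    using lyap_step_integrable by (simp add: prob_space)
  also have "\<dots> \<le> expectation (\<lambda>\<omega>. tent R (A \<omega> * x + B \<omega>))"
    using lyap_step_integrable tent_step_integrable[OF assms] by (intro integral_mono) (auto simp: tent_def)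
  finally show ?thesis using drift[of x] True by (simp add: tent_drift_def tent_def)
next
  case False
  have "0 \<le> expectation (\<lambda>\<omega>. tent R (A \<omega> * x + B \<omega>))" by (intro Bochner_Integration.integral_nonneg) (simp add: tent_bounds)
  moreover have "tent R x = 0" using False by (simp add: tent_def)
  ultimately have "0 \<le> tent_drift R x" by (simp add: tent_drift_def)
  moreover have "0 \<le> 25 * m4 * indicator core x" using m4_nonneg by simp
  ultimately show ?thesis using False by simp
qed

lemma core_indicator_integral:
  "integrable \<nu> (\<lambda>x. 25 * m4 * indicator core x)" "(\<integral>x. 25 * m4 * indicator core x \<partial>\<nu>) = 25 * m4 * measure \<nu> core"
  using core_finite by (auto simp: fmeasurable_def sets_nu)

text \<open>The drift of each tent has integral 0, so the gain over \<open>lyap x \<le> R\<close> is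
  paid for by the finite mass of \<open>core\<close>, uniformly in \<open>R\<close>. Monotone
  convergence removes the truncation.\<close>

lemma lyap_weight_integrable: "integrable \<nu> (\<lambda>x. 1 / lyap x ^ 3)"
proof -
  define f where "f n x = indicator {x. lyap x \<le> real n} x * (\<sigma>2 / (16 * lyap x ^ 3))" for n x
  have [measurable]: "f n \<in> borel_measurable borel" for n unfolding f_def by measurable
  have lp: "0 < lyap x" for x using lyap_ge_1[of x] by linarith
  have f0: "0 \<le> f n x" for n x unfolding f_def using \<sigma>2_pos lp[of x] by simp
  have f_int: "integrable \<nu> (f n)" for n
  proof (rule integrable_bounded_support[where c=\<sigma>2 and r="exp ((real n)\<^sup>2)"])
    show "\<bar>f n x\<bar> \<le> \<sigma>2" for x
    proof -
      have "\<sigma>2 / (16 * lyap x ^ 3) \<le> \<sigma>2 / 1" using one_le_power[OF lyap_ge_1[of x], of 3] \<sigma>2_pos lp[of x] by (intro divide_left_mono) auto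
      then show ?thesis using \<sigma>2_pos lp[of x] by (auto simp: f_def indicator_def)
    qed
    show "f n x \<noteq> 0 \<Longrightarrow> \<bar>x\<bar> \<le> exp ((real n)\<^sup>2)" for x
      by (rule abs_le_of_lyap_le) (simp add: f_def indicator_def split: if_splits)
  qed simp
  have ge: "f n x - 25 * m4 * indicator core x \<le> tent_drift (real n) x" for n x
    using tent_drift_ge[of "real n" x] by (simp add: f_def)
  have bound: "(\<integral>x. f n x \<partial>\<nu>) \<le> 25 * m4 * measure \<nu> core" for n
  proof -
    have "(\<integral>x. f n x - 25 * m4 * indicator core x \<partial>\<nu>) \<le> (\<integral>x. tent_drift (real n) x \<partial>\<nu>)"
      by (intro integral_mono Bochner_Integration.integrable_diff f_int core_indicator_integral(1) tent_drift_integral(1) ge) simp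
    also have "\<dots> = 0" by (rule tent_drift_integral) simp
    finally show ?thesis using f_int[of n] core_indicator_integral by simp
  qed
  have mono: "mono (\<lambda>n. f n x)" for x
    unfolding f_def using \<sigma>2_pos lp[of x] by (intro monoI mult_right_mono) (auto simp: indicator_def)
  have "incseq (\<lambda>n. \<integral>x. f n x \<partial>\<nu>)"
    using mono by (intro incseq_SucI integral_mono f_int) (auto simp: mono_def)
  then obtain L where L: "(\<lambda>n. \<integral>x. f n x \<partial>\<nu>) \<longlonglongrightarrow> L"
    using incseq_convergent bound by blast
  have "integrable \<nu> (\<lambda>x. \<sigma>2 / (16 * lyap x ^ 3))"
  proof (rule integrable_monotone_convergence[OF f_int _ _ L])
    show "AE x in \<nu>. mono (\<lambda>n. f n x)" using mono by simp
    show "AE x in \<nu>. (\<lambda>n. f n x) \<longlonglongrightarrow> \<sigma>2 / (16 * lyap x ^ 3)"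
    proof (rule AE_I2)
      fix x
      obtain N where N: "lyap x \<le> real N" using real_arch_simple by blast
      have "eventually (\<lambda>n. f n x = \<sigma>2 / (16 * lyap x ^ 3)) sequentially"
        using eventually_ge_at_top[of N] by eventually_elim (use N in \<open>auto simp: f_def\<close>)
      then show "(\<lambda>n. f n x) \<longlonglongrightarrow> \<sigma>2 / (16 * lyap x ^ 3)" by (rule tendsto_eventually)
    qed
  qed simp
  then have "integrable \<nu> (\<lambda>x. (16 / \<sigma>2) * (\<sigma>2 / (16 * lyap x ^ 3)))" by (rule integrable_mult_right)
  then show ?thesis using \<sigma>2_pos by simp
qed

lemma logsize_weight_integrable: "integrable \<nu> (\<lambda>x. 1 / (logsize x)\<^sup>2)"
proof (rule Bochner_Integration.integrable_bound[OF lyap_weight_integrable])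
  show "AE x in \<nu>. norm (1 / (logsize x)\<^sup>2) \<le> norm (1 / lyap x ^ 3)"
  proof (rule AE_I2)
    fix x
    have "lyap x ^ 3 \<le> (logsize x)\<^sup>2" using lyap_ge_1[of x] unfolding lyap_sq[symmetric] power_mult[symmetric]
      by (intro power_increasing) auto
    then show "norm (1 / (logsize x)\<^sup>2) \<le> norm (1 / lyap x ^ 3)"
      using lyap_ge_1[of x] by (auto intro!: divide_left_mono mult_pos_pos)
  qed
qed simp

text \<open>The function \<open>h\<close> is truncated by \<open>U n = tent n / n\<close>. The error \<open>I2 n\<close> is controlled by the
  \<open>L\<^sup>1\<close> norm of the drift of \<open>U n\<close>, which tends to zero because this drift has integral \<open>0\<close> and
  its negative part is of order \<open>1 / n\<close> and lives on \<open>core\<close>.\<close>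

lemma flux_zero:
  fixes h :: "real \<Rightarrow> real"
  assumes [measurable]: "h \<in> borel_measurable borel" and bdd: "\<And>x. \<bar>h x\<bar> \<le> c"
    and int: "integrable Q (\<lambda>p. h (Y p) - h (snd p))"
  shows "(\<integral>p. h (Y p) - h (snd p) \<partial>Q) = 0"
proof -
  have c0: "0 \<le> c" using bdd[of 0] by linarith
  define U where "U n x = tent (real (Suc n)) x / real (Suc n)" for n x
  have [measurable]: "U n \<in> borel_measurable borel" for n unfolding U_def by measurable
  have U01: "0 \<le> U n x" "U n x \<le> 1" for n x using tent_bounds[of "real (Suc n)" x] by (auto simp: U_def)
  define C where "C = 25 * m4 * measure \<nu> core"
  have U_int: "integrable \<nu> (U n)" for n unfolding U_def using tent_integrable[of "real (Suc n)"] by simp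
  have hU_int: "integrable \<nu> (\<lambda>x. h x * U n x)" for n
  proof (rule integrable_bounded_support[where c=c and r="exp ((real (Suc n))\<^sup>2)"])
    show "\<bar>h x * U n x\<bar> \<le> c" for x
      using mult_mono[OF bdd[of x] U01(2)[of n x]] U01[of n x] c0 by (simp add: abs_mult)
    show "h x * U n x \<noteq> 0 \<Longrightarrow> \<bar>x\<bar> \<le> exp ((real (Suc n))\<^sup>2)" for x
      by (rule tent_support) (simp add: U_def)
  qed simp
  \<comment> \<open>Discrete product rule: the increment of \<open>h * U n\<close> is the sum of the
    two integrands, one with the increment of \<open>h\<close> and one with that of the
    cutoff.\<close>
  define I1 where "I1 n = (\<integral>p. (h (Y p) - h (snd p)) * U n (Y p) \<partial>Q)" for n
  define I2 where "I2 n = (\<integral>p. h (snd p) * (U n (Y p) - U n (snd p)) \<partial>Q)" for n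
  have int1: "integrable Q (\<lambda>p. (h (Y p) - h (snd p)) * U n (Y p))" for n
    by (rule Bochner_Integration.integrable_bound[OF int]) (use U01 in \<open>auto simp: abs_mult mult_left_le\<close>)
  have int2: "integrable Q (\<lambda>p. h (snd p) * (U n (Y p) - U n (snd p)))" for n
  proof (rule Bochner_Integration.integrable_bound)
    show "integrable Q (\<lambda>p. c * (U n (Y p) - U n (snd p)))"
      using integral_increment(1)[OF U_int[of n]] by (rule integrable_mult_right)
    show "AE p in Q. norm (h (snd p) * (U n (Y p) - U n (snd p))) \<le> norm (c * (U n (Y p) - U n (snd p)))"
      using bdd c0 by (intro AE_I2) (auto simp: abs_mult intro!: mult_right_mono)
  qed simp
  have sum0: "I1 n + I2 n = 0" for n
  proof -
    have "I1 n + I2 n = (\<integral>p. h (Y p) * U n (Y p) - h (snd p) * U n (snd p) \<partial>Q)"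
      unfolding I1_def I2_def by (subst Bochner_Integration.integral_add[symmetric, OF int1 int2]) (simp add: algebra_simps)
    also have "\<dots> = 0" by (rule integral_increment(2)[OF hU_int])
    finally show ?thesis .
  qed
  have I2_bound: "\<bar>I2 n\<bar> \<le> 2 * c * C / real (Suc n)" for n
  proof -
    let ?D = "tent_drift (real (Suc n))"
    have D: "integrable \<nu> ?D" "(\<integral>x. ?D x \<partial>\<nu>) = 0" using tent_drift_integral[of "real (Suc n)"] by auto
    \<comment> \<open>As \<open>?D\<close> has integral 0, its absolute integral is twice that of
      its negative part, and the latter is dominated by the \<open>core\<close> term.\<close>
    have D': "\<bar>?D x\<bar> \<le> ?D x + 2 * (25 * m4 * indicator core x)" for x
    proof -
      have "0 \<le> indicator {x. lyap x \<le> real (Suc n)} x * (\<sigma>2 / (16 * lyap x ^ 3))"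
        using \<sigma>2_pos lyap_ge_1[of x] by simp
      then have "- (25 * m4 * indicator core x) \<le> ?D x" using tent_drift_ge[of "real (Suc n)" x] by simp
      moreover have "0 \<le> 25 * m4 * indicator core x" using m4_nonneg by simp
      ultimately show ?thesis by linarith
    qed
    have eq: "(\<integral>\<omega>. h x * (U n (A \<omega> * x + B \<omega>) - U n x) \<partial>M) = h x * ?D x / real (Suc n)" for x
      using tent_step_integrable[of "real (Suc n)" x] by (simp add: U_def tent_drift_def prob_space diff_divide_distrib right_diff_distrib)
    have "I2 n = (\<integral>x. \<integral>\<omega>. h x * (U n (A \<omega> * x + B \<omega>) - U n x) \<partial>M \<partial>\<nu>)"
      unfolding I2_def using integral_snd[of "\<lambda>\<omega> x. h x * (U n (A \<omega> * x + B \<omega>) - U n x)"] int2[of n]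
      by (simp add: case_prod_beta')
    also have "\<dots> = (\<integral>x. h x * ?D x / real (Suc n) \<partial>\<nu>)" unfolding eq ..
    finally have "\<bar>I2 n\<bar> \<le> (\<integral>x. \<bar>h x * ?D x / real (Suc n)\<bar> \<partial>\<nu>)" using integral_abs_bound by metis
    also have "\<dots> \<le> (\<integral>x. c * (?D x + 2 * (25 * m4 * indicator core x)) / real (Suc n) \<partial>\<nu>)"
    proof (rule integral_mono')
      show "integrable \<nu> (\<lambda>x. c * (?D x + 2 * (25 * m4 * indicator core x)) / real (Suc n))"
        using D core_indicator_integral(1) by (intro integrable_divide integrable_mult_right Bochner_Integration.integrable_add) auto
      fix x
      have "\<bar>h x * ?D x\<bar> \<le> c * (?D x + 2 * (25 * m4 * indicator core x))"
        unfolding abs_mult using bdd D' c0 by (intro mult_mono) auto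
      then show "\<bar>h x * ?D x / real (Suc n)\<bar> \<le> c * (?D x + 2 * (25 * m4 * indicator core x)) / real (Suc n)"
        by (simp add: divide_right_mono)
      show "0 \<le> c * (?D x + 2 * (25 * m4 * indicator core x)) / real (Suc n)" 
        using c0 D'[of x] by (intro divide_nonneg_nonneg mult_nonneg_nonneg) auto
    qed
    also have "\<dots> = 2 * c * C / real (Suc n)"
    proof -
      have "(\<integral>x. ?D x + 2 * (25 * m4 * indicator core x) \<partial>\<nu>) = 2 * C"
        using D core_indicator_integral by (subst Bochner_Integration.integral_add) (auto simp: C_def)
      then show ?thesis by simp
    qed
    finally show ?thesis .
  qed
  have "I2 \<longlonglongrightarrow> 0"
  proof (rule Lim_null_comparison)
    show "eventually (\<lambda>n. norm (I2 n) \<le> 2 * c * C / real (Suc n)) sequentially" using I2_bound by simp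
    show "(\<lambda>n. 2 * c * C / real (Suc n)) \<longlonglongrightarrow> 0" by (rule LIMSEQ_Suc[OF lim_const_over_n])
  qed
  then have "I1 \<longlonglongrightarrow> 0"
  proof -
    assume "I2 \<longlonglongrightarrow> 0"
    moreover have "I1 = (\<lambda>n. - I2 n)" using sum0 by (auto simp: fun_eq_iff eq_neg_iff_add_eq_0)
    ultimately show ?thesis using tendsto_minus[of I2 0 sequentially] by simp
  qed
  moreover have "I1 \<longlonglongrightarrow> (\<integral>p. h (Y p) - h (snd p) \<partial>Q)"
    unfolding I1_def
  proof (rule integral_dominated_convergence[where w="\<lambda>p. \<bar>h (Y p) - h (snd p)\<bar>"])
    show "integrable Q (\<lambda>p. \<bar>h (Y p) - h (snd p)\<bar>)" using int by simp
    show "AE p in Q. norm ((h (Y p) - h (snd p)) * U n (Y p)) \<le> \<bar>h (Y p) - h (snd p)\<bar>" for n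
      using U01 by (intro AE_I2) (auto simp: abs_mult mult_left_le)
    show "AE p in Q. (\<lambda>n. (h (Y p) - h (snd p)) * U n (Y p)) \<longlonglongrightarrow> h (Y p) - h (snd p)"
    proof (rule AE_I2)
      fix p
      have "(\<lambda>n. U n (Y p)) \<longlonglongrightarrow> 1"
      proof (rule Lim_transform_eventually)
        show "(\<lambda>n. 1 - lyap (Y p) / real (Suc n)) \<longlonglongrightarrow> 1"
          using tendsto_diff[OF tendsto_const[of 1] LIMSEQ_Suc[OF lim_const_over_n[of "lyap (Y p)"]]] by simp
        obtain N where N: "lyap (Y p) \<le> real N" using real_arch_simple by blast
        show "eventually (\<lambda>n. 1 - lyap (Y p) / real (Suc n) = U n (Y p)) sequentially"
          using eventually_ge_at_top[of N]
          by eventually_elim (use N in \<open>auto simp: U_def tent_def max_def field_simps\<close>)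
      qed
      from tendsto_mult_left[OF this, of "h (Y p) - h (snd p)"]
      show "(\<lambda>n. (h (Y p) - h (snd p)) * U n (Y p)) \<longlonglongrightarrow> h (Y p) - h (snd p)" by simp
    qed
  qed measurable
  ultimately show ?thesis by (rule LIMSEQ_unique[symmetric])
qed

section \<open>Comparison with the additive walk\<close>

text \<open>The bound of \<open>poslog_defect\<close> up to the factor 32, as a product of a
  function of the map and a function of the starting point. This one integrable function dominates
  all defects below.\<close>

definition defect_bound :: "'w \<times> real \<Rightarrow> real" where
  "defect_bound p = w (fst p) ^ 3 * (1 / (logsize (snd p))\<^sup>2)"

lemma defect_bound_integrable: "integrable Q defect_bound"
  unfolding defect_bound_def[abs_def]
  by (rule integrable_product[OF w_power_integrable logsize_weight_integrable]) simp

lemma defect_bound_nonneg: "0 \<le> defect_bound p"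
  unfolding defect_bound_def by (intro mult_nonneg_nonneg zero_le_power order_trans[OF zero_le_one cost_ge_1]) simp

definition walk :: "'w \<times> real \<Rightarrow> real" where
  "walk p = poslog (snd p) + \<xi> (fst p)"

lemma walk_measurable [measurable]: "walk \<in> borel_measurable Q"
  unfolding walk_def[abs_def] by measurable

text \<open>The error made by replacing the step by the additive walk, for a test function \<open>\<psi>\<close> of the
  coordinate \<open>poslog\<close>. Starting points \<open>x \<le> 0\<close> are collapsed to the coordinate \<open>0\<close>, where \<open>\<psi>\<close>
  vanishes in all applications.\<close>

definition defect :: "(real \<Rightarrow> real) \<Rightarrow> 'w \<times> real \<Rightarrow> real" where
  "defect \<psi> p = \<psi> (poslog (Y p)) - (if 0 < snd p then \<psi> (walk p) else 0)"

lemma defect_measurable [measurable]: 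
  assumes [measurable]: "\<psi> \<in> borel_measurable borel" shows "defect \<psi> \<in> borel_measurable Q"
  unfolding defect_def[abs_def] by measurable

lemma defect_id_le: "\<bar>defect (\<lambda>s. s) p\<bar> \<le> 32 * defect_bound p"
  using poslog_defect[of "A (fst p)" "snd p" "B (fst p)"] by (cases "0 < snd p") (simp_all add: defect_def walk_def defect_bound_def)

text \<open>A Lipschitz function enlarges the defect of the identity by at most the factor
  \<open>l\<close>. For nonpositive starting points the comparison value 0 is
  \<open>\<psi> 0\<close>.\<close>

lemma defect_le:
  assumes "\<And>s t. \<bar>\<psi> s - \<psi> t\<bar> \<le> l * \<bar>s - t\<bar>" "\<psi> 0 = 0"
  shows "\<bar>defect \<psi> p\<bar> \<le> l * (32 * defect_bound p)"
proof -
  have l: "0 \<le> l" using assms(1)[of 1 0] by simp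
  have "\<bar>defect \<psi> p\<bar> \<le> l * \<bar>defect (\<lambda>s. s) p\<bar>"
    using assms(1)[of "poslog (Y p)" "walk p"] assms(1)[of "poslog (Y p)" 0] assms(2)
    by (auto simp: defect_def)
  also have "\<dots> \<le> l * (32 * defect_bound p)" by (intro mult_left_mono defect_id_le l)
  finally show ?thesis .
qed

lemma defect_integrable:
  assumes [measurable]: "\<psi> \<in> borel_measurable borel"
    and "\<And>s t. \<bar>\<psi> s - \<psi> t\<bar> \<le> l * \<bar>s - t\<bar>" "\<psi> 0 = 0"
  shows "integrable Q (defect \<psi>)"
proof (rule Bochner_Integration.integrable_bound)
  show "integrable Q (\<lambda>p. l * (32 * defect_bound p))" using defect_bound_integrable by simp
  show "AE p in Q. norm (defect \<psi> p) \<le> norm (l * (32 * defect_bound p))"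
    using order_trans[OF defect_le[OF assms(2,3)] abs_ge_self] by simp
qed simp

text \<open>The common Lipschitz constant provides one dominating function for all large
  \<open>t\<close>.\<close>

lemma defect_integral_tendsto:
  fixes \<psi> :: "real \<Rightarrow> real \<Rightarrow> real"
  assumes [measurable]: "\<And>t. \<psi> t \<in> borel_measurable borel" "\<psi>' \<in> borel_measurable borel"
    and lip: "\<And>t r s. \<bar>\<psi> t r - \<psi> t s\<bar> \<le> l * \<bar>r - s\<bar>"
    and zero: "eventually (\<lambda>t. \<psi> t 0 = 0) at_top"
    and lim: "\<And>s. ((\<lambda>t. \<psi> t s) \<longlongrightarrow> \<psi>' s) at_top"
  shows "((\<lambda>t. \<integral>p. defect (\<psi> t) p \<partial>Q) \<longlongrightarrow> (\<integral>p. defect \<psi>' p \<partial>Q)) at_top"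
proof (rule integral_dominated_convergence_at_top[where w="\<lambda>p. l * (32 * defect_bound p)"])
  show "integrable Q (\<lambda>p. l * (32 * defect_bound p))" using defect_bound_integrable by simp
  show "eventually (\<lambda>t. AE p in Q. norm (defect (\<psi> t) p) \<le> l * (32 * defect_bound p)) at_top"
    using zero by eventually_elim (use defect_le[OF lip] in auto)
  show "AE p in Q. ((\<lambda>t. defect (\<psi> t) p) \<longlongrightarrow> defect \<psi>' p) at_top"
    by (rule AE_I2) (auto simp: defect_def intro!: tendsto_intros lim)
qed measurable

section \<open>The kernel of the centred walk\<close>

text \<open>\<open>k (t - s)\<close> is the mean loss of \<open>min s t\<close> when
  \<open>s\<close> moves to \<open>s + \<xi>\<close>. In this form no case distinction on the sign
  of \<open>t - s\<close> is needed.\<close>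

definition k :: "real \<Rightarrow> real" where
  "k u = expectation (\<lambda>\<omega>. min 0 u - min (\<xi> \<omega>) u)"

lemma min_xi_integrable: "integrable M (\<lambda>\<omega>. min (\<xi> \<omega>) u)"
  using xi_integrable by (intro integrable_min) auto

lemma k_lipschitz: "\<bar>k u - k v\<bar> \<le> 2 * \<bar>u - v\<bar>"
proof -
  have "\<bar>k u - k v\<bar> = \<bar>expectation (\<lambda>\<omega>. (min 0 u - min (\<xi> \<omega>) u) - (min 0 v - min (\<xi> \<omega>) v))\<bar>"
    unfolding k_def using min_xi_integrable by (subst Bochner_Integration.integral_diff) auto
  also have "\<dots> \<le> expectation (\<lambda>\<omega>. \<bar>(min 0 u - min (\<xi> \<omega>) u) - (min 0 v - min (\<xi> \<omega>) v)\<bar>)"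
    by (rule integral_abs_bound)
  also have "\<dots> \<le> expectation (\<lambda>\<omega>. 2 * \<bar>u - v\<bar>)"
      proof (rule integral_mono)
    have lip: "\<bar>min x u - min x v\<bar> \<le> \<bar>u - v\<bar>" for x :: real by (auto simp: min_def)
    have tri: "\<bar>p - q - (p' - q')\<bar> \<le> 2 * e" if "\<bar>p - p'\<bar> \<le> e" "\<bar>q - q'\<bar> \<le> e" for p q p' q' e :: real
      using that by linarith
    show "\<bar>(min 0 u - min (\<xi> \<omega>) u) - (min 0 v - min (\<xi> \<omega>) v)\<bar> \<le> 2 * \<bar>u - v\<bar>" for \<omega>
      by (intro tri lip)
  qed (use min_xi_integrable in auto)
  finally show ?thesis by (simp add: prob_space)
qed

lemma k_continuous: "continuous_on UNIV k"
  by (rule lipschitz_on_continuous_on[of 2]) (use k_lipschitz in \<open>auto simp: lipschitz_on_def dist_real_def\<close>)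

lemma k_measurable [measurable]: "k \<in> borel_measurable borel"
  by (rule borel_measurable_continuous_onI[OF k_continuous])

text \<open>For \<open>0 \<le> u\<close> the vanishing mean of \<open>\<xi>\<close> is added to the
  integrand. The result is an integrated tail of the law of \<open>\<xi>\<close>, which makes
  positivity and decay visible.\<close>

lemma k_eq_nonneg_part: "k u = expectation (\<lambda>\<omega>. if 0 \<le> u then max 0 (\<xi> \<omega> - u) else max 0 (u - \<xi> \<omega>))"
proof (cases "0 \<le> u")
  case True
  have "k u = expectation (\<lambda>\<omega>. min 0 u - min (\<xi> \<omega>) u) + expectation \<xi>" by (simp add: k_def centered)
  also have "\<dots> = expectation (\<lambda>\<omega>. (min 0 u - min (\<xi> \<omega>) u) + \<xi> \<omega>)"
    using min_xi_integrable xi_integrable by (subst Bochner_Integration.integral_add) auto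
  also have "\<dots> = expectation (\<lambda>\<omega>. max 0 (\<xi> \<omega> - u))"
    using True by (intro Bochner_Integration.integral_cong) (auto simp: min_def max_def)
  finally show ?thesis using True by simp
next
  case False
  then show ?thesis unfolding k_def by (intro Bochner_Integration.integral_cong) (auto simp: min_def max_def)
qed

lemma k_nonneg: "0 \<le> k u"
  unfolding k_eq_nonneg_part by (intro Bochner_Integration.integral_nonneg) auto

text \<open>\<open>k 0\<close> is the mean of the positive part of \<open>\<xi>\<close>. Were it 0,
  centring would force \<open>\<xi> = 0\<close> almost surely, against the positive second
  moment.\<close>

lemma k_0_pos: "0 < k 0"
proof (rule ccontr)
  assume "\<not> 0 < k 0"
  then have "k 0 = 0" using k_nonneg[of 0] by simp
  have int: "integrable M (\<lambda>\<omega>. max 0 (\<xi> \<omega>))" using xi_integrable by (intro integrable_max) auto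
  have "expectation (\<lambda>\<omega>. \<bar>\<xi> \<omega>\<bar>) = expectation (\<lambda>\<omega>. 2 * max 0 (\<xi> \<omega>) - \<xi> \<omega>)"
    by (intro Bochner_Integration.integral_cong) auto
  also have "\<dots> = 2 * k 0" using int xi_integrable by (simp add: k_eq_nonneg_part[of 0] centered)
  finally have "expectation (\<lambda>\<omega>. \<bar>\<xi> \<omega>\<bar>) = 0" using \<open>k 0 = 0\<close> by simp
  then have "AE \<omega> in M. \<bar>\<xi> \<omega>\<bar> = 0"
    using xi_integrable by (subst (asm) integral_nonneg_eq_0_iff_AE) auto
  then have "expectation (\<lambda>\<omega>. (\<xi> \<omega>)\<^sup>2) = expectation (\<lambda>_. 0)"
    by (intro integral_cong_AE) auto
  then show False using nondegenerate by simp
qed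

text \<open>The integrand vanishes unless
  \<open>\<bar>u\<bar> \<le> \<bar>\<xi> \<omega>\<bar>\<close>, and there
  \<open>1 + u\<^sup>2\<close> is at most the square of the cost.\<close>

lemma k_decay: "k u \<le> m4 / (1 + u\<^sup>2)"
proof -
  have "(1 + u\<^sup>2) * k u = expectation (\<lambda>\<omega>. (1 + u\<^sup>2) * (if 0 \<le> u then max 0 (\<xi> \<omega> - u) else max 0 (u - \<xi> \<omega>)))"
    by (simp add: k_eq_nonneg_part)
  also have "\<dots> \<le> expectation (\<lambda>\<omega>. w \<omega> ^ 4)"
  proof (rule integral_mono)
    show "integrable M (\<lambda>\<omega>. (1 + u\<^sup>2) * (if 0 \<le> u then max 0 (\<xi> \<omega> - u) else max 0 (u - \<xi> \<omega>)))"
      using xi_integrable by (cases "0 \<le> u") (auto intro!: integrable_max integrable_mult_right)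
    show "integrable M (\<lambda>\<omega>. w \<omega> ^ 4)" by (rule w_power_integrable) simp
    fix \<omega>
    let ?d = "if 0 \<le> u then max 0 (\<xi> \<omega> - u) else max 0 (u - \<xi> \<omega>)"
    show "(1 + u\<^sup>2) * ?d \<le> w \<omega> ^ 4"
    proof (cases "\<bar>u\<bar> \<le> \<bar>\<xi> \<omega>\<bar>")
      case True
      have "1 + u\<^sup>2 \<le> (1 + \<bar>\<xi> \<omega>\<bar>)\<^sup>2" using True abs_le_square_iff[of u "\<xi> \<omega>"] by (simp add: power2_sum)
      also have "\<dots> \<le> w \<omega> ^ 2" using abs_xi_le by (intro power_mono) auto
      finally have 1: "1 + u\<^sup>2 \<le> w \<omega> ^ 2" .
      have 2: "?d \<le> w \<omega> ^ 1" using True abs_xi_le[of \<omega>] by auto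
      have "(1 + u\<^sup>2) * ?d \<le> w \<omega> ^ 2 * w \<omega> ^ 1" by (intro mult_mono 1 2) auto
      also have "\<dots> \<le> w \<omega> ^ 4" unfolding power_add[symmetric] by (intro power_increasing) auto
      finally show ?thesis .
    next
      case False
      then have "?d = 0" by (auto simp: max_def)
      then show ?thesis by (simp add: order_trans[OF zero_le_one one_le_power])
    qed
  qed
  finally show ?thesis by (simp add: m4_def field_simps add_pos_nonneg)
qed

lemma k_integrable: "integrable lborel k"
proof (rule Bochner_Integration.integrable_bound)
  have "integrable lborel (\<lambda>x::real. inverse (1 + x\<^sup>2))"
    using integrable_inverse_1_plus_square by (simp add: set_integrable_def)
  then show "integrable lborel (\<lambda>x::real. m4 * inverse (1 + x\<^sup>2))" by simp
  show "AE u in lborel. norm (k u) \<le> norm (m4 * inverse (1 + u\<^sup>2))"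
    using k_decay k_nonneg m4_nonneg by (intro AE_I2) (auto simp: divide_inverse abs_mult)
qed simp

lemma k_integral_pos: "0 < (\<integral>u. k u \<partial>lborel)"
proof -
  define r where "r = k 0 / 4"
  have r: "r > 0" using k_0_pos by (simp add: r_def)
  have "0 < k 0 / 2 * (2 * r)" using r k_0_pos by simp
  also have "\<dots> = (\<integral>u. k 0 / 2 * indicator {-r..r} u \<partial>lborel)" using r by simp
  also have "\<dots> \<le> (\<integral>u. k u \<partial>lborel)"
  proof (rule integral_mono)
    show "k 0 / 2 * indicator {-r..r} u \<le> k u" for u
      using k_lipschitz[of u 0] k_nonneg[of u] by (auto simp: indicator_def r_def)
    show "integrable lborel (\<lambda>u. k 0 / 2 * indicator {-r..r} u)"
      using r by (intro integrable_mult_right integrable_real_indicator) auto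
  qed (rule k_integrable)
  finally show ?thesis .
qed

section \<open>Kernel averages of the invariant measure\<close>

definition G :: "real \<Rightarrow> real" where
  "G t = (\<integral>x. (if 0 < x then k (t - poslog x) else 0) \<partial>\<nu>)"

lemma G_nonneg: "0 \<le> G t"
  unfolding G_def by (intro Bochner_Integration.integral_nonneg) (simp add: k_nonneg)

text \<open>The increment of \<open>min (poslog x) t\<close> is the defect minus the loss
  \<open>q\<close> of the additive walk. By \<open>flux_zero\<close> the two have equal integrals,
  and averaging \<open>q\<close> over the random map produces \<open>k\<close>.\<close>

lemma G_eq_defect:
  assumes t: "0 \<le> t"
  shows "integrable \<nu> (\<lambda>x. if 0 < x then k (t - poslog x) else 0)"
    and "G t = (\<integral>p. defect (\<lambda>s. min s t) p \<partial>Q)"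
proof -
  define q where "q p = (if 0 < snd p then min (poslog (snd p)) t - min (walk p) t else 0)" for p
  have [measurable]: "q \<in> borel_measurable Q" unfolding q_def by measurable
  \<comment> \<open>A nonzero loss requires \<open>poslog x \<le> t + \<bar>\<xi>\<bar>\<close>,
    hence \<open>logsize x \<le> (1 + t) * w\<close>. This turns the trivial bound \<open>w\<close>
    into a multiple of \<open>defect_bound\<close>.\<close>
  have q_bound: "\<bar>q p\<bar> \<le> (1 + t)\<^sup>2 * defect_bound p" for p
  proof (cases "q p = 0")
    case True then show ?thesis using defect_bound_nonneg by simp
  next
    case False
    let ?w = "w (fst p)"
    have x: "0 < snd p" using False by (simp add: q_def split: if_splits)
    have "poslog (snd p) \<le> t + \<bar>\<xi> (fst p)\<bar>" using False x by (auto simp: q_def walk_def min_def split: if_splits)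
    then have "logsize (snd p) \<le> 1 + t + \<bar>\<xi> (fst p)\<bar>" using x by (simp add: poslog_eq_logsize)
    also have "\<dots> \<le> (1 + t) * (1 + \<bar>\<xi> (fst p)\<bar>)" using t by (simp add: algebra_simps)
    also have "\<dots> \<le> (1 + t) * ?w" using t abs_xi_le by (intro mult_left_mono) auto
    finally have ls: "logsize (snd p) \<le> (1 + t) * ?w" .
    have "\<bar>q p\<bar> \<le> ?w" using x abs_xi_le[of "fst p"] by (auto simp: q_def walk_def min_def)
    then have "\<bar>q p\<bar> * (logsize (snd p))\<^sup>2 \<le> ?w * ((1 + t) * ?w)\<^sup>2" 
      using ls by (intro mult_mono power_mono) (auto simp: order_less_imp_le order_trans[OF zero_le_one cost_ge_1])
    also have "\<dots> = (1 + t)\<^sup>2 * ?w ^ 3" by (simp add: power2_eq_square power3_eq_cube)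
    finally show ?thesis by (simp add: defect_bound_def pos_le_divide_eq[OF zero_less_power[OF logsize_pos]])
  qed
  have q_int: "integrable Q q"
  proof (rule Bochner_Integration.integrable_bound)
    show "integrable Q (\<lambda>p. (1 + t)\<^sup>2 * defect_bound p)" using defect_bound_integrable by simp
    show "AE p in Q. norm (q p) \<le> norm ((1 + t)\<^sup>2 * defect_bound p)"
      using order_trans[OF q_bound abs_ge_self] by simp
  qed simp
  have d_int: "integrable Q (defect (\<lambda>s. min s t))"
    by (rule defect_integrable[where l=1]) (use t in \<open>auto simp: min_def\<close>)
  define h where "h x = min (poslog x) t" for x
  have [measurable]: "h \<in> borel_measurable borel" unfolding h_def[abs_def] by measurable
  have split: "h (Y p) - h (snd p) = defect (\<lambda>s. min s t) p - q p" for p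
    using t by (simp add: h_def defect_def q_def)
  have "(\<integral>p. h (Y p) - h (snd p) \<partial>Q) = 0"
  proof (rule flux_zero)
    show "\<bar>h x\<bar> \<le> t" for x using t by (simp add: h_def)
    show "integrable Q (\<lambda>p. h (Y p) - h (snd p))" unfolding split using d_int q_int by simp
  qed simp
  then have eq: "(\<integral>p. q p \<partial>Q) = (\<integral>p. defect (\<lambda>s. min s t) p \<partial>Q)"
    unfolding split using d_int q_int by simp
  have inner: "(\<integral>\<omega>. q (\<omega>, x) \<partial>M) = (if 0 < x then k (t - poslog x) else 0)" for x
  proof (cases "0 < x")
    case True
    then have "q (\<omega>, x) = min 0 (t - poslog x) - min (\<xi> \<omega>) (t - poslog x)" for \<omega>
      by (simp add: q_def walk_def min_def)
    then show ?thesis using True by (simp only: k_def if_True)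
  qed (simp add: q_def)
  have q_int': "integrable Q (\<lambda>(\<omega>, x). q (\<omega>, x))" using q_int by simp
  from integrable_snd[OF q_int'] show "integrable \<nu> (\<lambda>x. if 0 < x then k (t - poslog x) else 0)"
    unfolding inner .
  from integral_snd[OF q_int'] show "G t = (\<integral>p. defect (\<lambda>s. min s t) p \<partial>Q)"
    unfolding inner G_def using eq by simp
qed

text \<open>Divided by the integral of \<open>k\<close>, this total defect of the coordinate becomes
  the constant \<open>C_lim\<close>.\<close>

definition b :: real where "b = (\<integral>p. defect (\<lambda>s. s) p \<partial>Q)"

lemma G_tendsto: "(G \<longlongrightarrow> b) at_top"
proof (rule Lim_transform_eventually)
  show "((\<lambda>t. \<integral>p. defect (\<lambda>s. min s t) p \<partial>Q) \<longlongrightarrow> b) at_top"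
    unfolding b_def
  proof (rule defect_integral_tendsto[where l=1])
    show "eventually (\<lambda>t. min 0 t = (0::real)) at_top"
      using eventually_ge_at_top[of 0] by eventually_elim simp
    show "((\<lambda>t. min s t) \<longlongrightarrow> s) at_top" for s :: real
      by (rule tendsto_eventually) (use eventually_ge_at_top[of s] in eventually_elim, simp)
  qed (auto simp: min_def)
  show "eventually (\<lambda>t. (\<integral>p. defect (\<lambda>s. min s t) p \<partial>Q) = G t) at_top"
    using eventually_ge_at_top[of 0] by eventually_elim (simp add: G_eq_defect)
qed

lemma b_nonneg: "0 \<le> b"
  by (rule tendsto_lowerbound[OF G_tendsto]) (auto simp: G_nonneg)

definition Gmax :: real where "Gmax = 32 * (\<integral>p. defect_bound p \<partial>Q)"

lemma G_le: "0 \<le> t \<Longrightarrow> G t \<le> Gmax"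
proof -
  assume t: "0 \<le> t"
  have "G t \<le> (\<integral>p. \<bar>defect (\<lambda>s. min s t) p\<bar> \<partial>Q)" using integral_abs_bound[of Q "defect (\<lambda>s. min s t)"] G_eq_defect(2)[OF t] by linarith
  also have "\<dots> \<le> (\<integral>p. 32 * defect_bound p \<partial>Q)"
  proof (rule integral_mono')
    show "\<bar>defect (\<lambda>s. min s t) p\<bar> \<le> 32 * defect_bound p" for p
      using defect_le[of "\<lambda>s. min s t" 1 p] t by (auto simp: min_def)
  qed (use defect_bound_integrable defect_bound_nonneg in auto)
  finally show ?thesis by (simp add: Gmax_def)
qed

section \<open>Uniform mass bounds for logarithmic windows\<close>

definition band :: "real \<Rightarrow> real \<Rightarrow> real set" where
  "band t r = {x. 0 < x \<and> \<bar>poslog x - t\<bar> \<le> r}"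

lemma band_measurable [measurable]: "band t r \<in> sets borel"
  unfolding band_def by measurable

lemma band_finite: "band t r \<in> fmeasurable \<nu>"
proof (rule finite_on_bounded)
  fix x assume "x \<in> band t r"
  then have x: "0 < x" "ln (1 + x) \<le> t + r" by (auto simp: band_def poslog_def)
  then have "1 + x \<le> exp (t + r)" by (metis add_pos_pos exp_le_cancel_iff exp_ln zero_less_one)
  then show "\<bar>x\<bar> \<le> exp (t + r)" using x by simp
qed simp

text \<open>Since \<open>k\<close> is bounded below near 0, the bound on \<open>G\<close> controls
  the mass of short windows. Longer windows are unions of two shorter ones shifted by
  \<open>\<rho>\<close>, repeated finitely often.\<close>

lemma band_bounded: "\<exists>C. \<forall>t. measure \<nu> (band t r) \<le> C"
proof -
  \<comment> \<open>As \<open>k\<close> has Lipschitz constant 2, it is at least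
    \<open>k 0 / 2\<close> within this distance of 0.\<close>
  define \<rho> where "\<rho> = k 0 / 4"
  have \<rho>: "0 < \<rho>" using k_0_pos by (simp add: \<rho>_def)
  define C0 where "C0 = 2 * Gmax / k 0"
  have base0: "measure \<nu> (band t \<rho>) \<le> C0" if "0 \<le> t" for t
  proof -
    have "k 0 / 2 * measure \<nu> (band t \<rho>) = (\<integral>x. k 0 / 2 * indicator (band t \<rho>) x \<partial>\<nu>)" by (simp add: sets_nu)
    also have "\<dots> \<le> G t" unfolding G_def
    proof (rule integral_mono[OF _ G_eq_defect(1)[OF that]])
      show "integrable \<nu> (\<lambda>x. k 0 / 2 * indicator (band t \<rho>) x)"
        using band_finite[of t \<rho>] by (auto simp: fmeasurable_def sets_nu)
      show "k 0 / 2 * indicator (band t \<rho>) x \<le> (if 0 < x then k (t - poslog x) else 0)" for x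
        using k_lipschitz[of "t - poslog x" 0] k_nonneg[of "t - poslog x"] abs_minus_commute[of t "poslog x"]
        by (auto simp: indicator_def band_def \<rho>_def)
    qed
    also have "\<dots> \<le> Gmax" by (rule G_le[OF that])
    finally show ?thesis using k_0_pos by (simp add: C0_def field_simps)
  qed
  have base: "measure \<nu> (band t \<rho>) \<le> C0" for t
  proof (cases "0 \<le> t")
    case False
    \<comment> \<open>A window centred to the left of 0 is contained in the one centred at 0,
      because \<open>poslog\<close> is nonnegative.\<close>
    have "band t \<rho> \<subseteq> band 0 \<rho>" using False by (auto simp: band_def)
    then have "measure \<nu> (band t \<rho>) \<le> measure \<nu> (band 0 \<rho>)" 
      using band_finite by (intro measure_mono_fmeasurable) (auto simp: sets_nu)
    then show ?thesis using base0[of 0] by simp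
  qed (rule base0)
  have "\<exists>C. \<forall>t. measure \<nu> (band t (real (Suc n) * \<rho>)) \<le> C" for n
  proof (induction n)
    case 0 show ?case using base by auto
  next
    case (Suc n)
    then obtain C where C: "\<And>t. measure \<nu> (band t (real (Suc n) * \<rho>)) \<le> C" by blast
    have "measure \<nu> (band t (real (Suc (Suc n)) * \<rho>)) \<le> C + C" for t
    proof -
      define s where "s = real (Suc n) * \<rho>"
      have s: "\<rho> \<le> s" "real (Suc (Suc n)) * \<rho> = s + \<rho>" using \<rho> by (simp_all add: s_def algebra_simps)
      have "band t (s + \<rho>) \<subseteq> band (t - \<rho>) s \<union> band (t + \<rho>) s"
        using s \<rho> unfolding band_def by (auto simp: abs_le_iff)
      then have "measure \<nu> (band t (s + \<rho>)) \<le> measure \<nu> (band (t - \<rho>) s \<union> band (t + \<rho>) s)"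
        using band_finite by (intro measure_mono_fmeasurable fmeasurable.Un) (auto simp: sets_nu)
      also have "\<dots> \<le> measure \<nu> (band (t - \<rho>) s) + measure \<nu> (band (t + \<rho>) s)"
        by (intro measure_Un_le) (auto simp: sets_nu)
      finally show ?thesis using C[of "t - \<rho>"] C[of "t + \<rho>"] unfolding s(2) s_def[symmetric] by linarith
    qed
    then show ?case by blast
  qed
  moreover obtain n where "r \<le> real n * \<rho>" using reals_Archimedean3[OF \<rho>] by (metis less_imp_le)
  ultimately obtain C where C: "\<And>t. measure \<nu> (band t (real (Suc n) * \<rho>)) \<le> C" by blast
  have "measure \<nu> (band t r) \<le> C" for t
  proof -
    have "band t r \<subseteq> band t (real (Suc n) * \<rho>)" using \<open>r \<le> real n * \<rho>\<close> \<rho> by (auto simp: band_def algebra_simps)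
    then have "measure \<nu> (band t r) \<le> measure \<nu> (band t (real (Suc n) * \<rho>))"
      using band_finite by (intro measure_mono_fmeasurable) (auto simp: sets_nu)
    then show ?thesis using C[of t] by simp
  qed
  then show ?thesis by blast
qed

section \<open>Smoothed window masses and their limit\<close>

definition F :: "(real \<Rightarrow> real) \<Rightarrow> real \<Rightarrow> real" where
  "F \<phi> t = (\<integral>x. (if 0 < x then \<phi> (poslog x - t) else 0) \<partial>\<nu>)"

lemma F_measurable [measurable]:
  assumes [measurable]: "\<phi> \<in> borel_measurable borel"
  shows "F \<phi> \<in> borel_measurable borel"
  unfolding F_def[abs_def] by measurable

lemma band_indicator_integral:
  "integrable \<nu> (\<lambda>x. u * indicator (band t r) x)" "(\<integral>x. u * indicator (band t r) x \<partial>\<nu>) = u * measure \<nu> (band t r)"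
  for u :: real
  using band_finite[of t r] by (auto simp: fmeasurable_def sets_nu)

context
  fixes \<phi> :: "real \<Rightarrow> real" and l a c :: real
  assumes phi_measurable [measurable]: "\<phi> \<in> borel_measurable borel"
    and lip: "\<bar>\<phi> s - \<phi> t\<bar> \<le> l * \<bar>s - t\<bar>"
    and supp: "\<phi> s \<noteq> 0 \<Longrightarrow> \<bar>s\<bar> \<le> a"
    and bdd: "0 \<le> \<phi> s" "\<phi> s \<le> c"
begin

lemma c_nonneg: "0 \<le> c" using bdd[of 0] by linarith

lemma F_integrand_bound:
  "\<bar>if 0 < x then \<phi> (poslog x - t) else 0\<bar> \<le> c * indicator (band t a) x"
  using supp[of "poslog x - t"] bdd[of "poslog x - t"] c_nonneg by (auto simp: indicator_def band_def)

lemma F_integrable: "integrable \<nu> (\<lambda>x. if 0 < x then \<phi> (poslog x - t) else 0)"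
proof (rule Bochner_Integration.integrable_bound[OF band_indicator_integral(1)])
  show "AE x in \<nu>. norm (if 0 < x then \<phi> (poslog x - t) else 0) \<le> norm (c * indicator (band t a) x)"
    using order_trans[OF F_integrand_bound abs_ge_self] by simp
qed simp

lemma F_nonneg: "0 \<le> F \<phi> t"
  unfolding F_def by (intro Bochner_Integration.integral_nonneg) (simp add: bdd)

lemma F_bounded: "\<exists>K. \<forall>t. \<bar>F \<phi> t\<bar> \<le> K"
proof -
  obtain C where C: "\<And>t. measure \<nu> (band t a) \<le> C" using band_bounded[of a] by blast
  have "\<bar>F \<phi> t\<bar> \<le> c * C" for t
  proof -
    have "\<bar>F \<phi> t\<bar> \<le> (\<integral>x. \<bar>if 0 < x then \<phi> (poslog x - t) else 0\<bar> \<partial>\<nu>)" unfolding F_def by (rule integral_abs_bound)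
    also have "\<dots> \<le> (\<integral>x. c * indicator (band t a) x \<partial>\<nu>)"
      using F_integrand_bound c_nonneg by (intro integral_mono' band_indicator_integral(1)) auto
    also have "\<dots> \<le> c * C" unfolding band_indicator_integral(2) using C c_nonneg by (intro mult_left_mono)
    finally show ?thesis .
  qed
  then show ?thesis by blast
qed

text \<open>For shifts of at most 1 the two integrands differ by
  \<open>l * \<bar>s - t\<bar>\<close> at most, and only on a window widened by 1, whose mass is
  bounded. For larger shifts boundedness of \<open>F\<close> suffices.\<close>

lemma F_lipschitz: "\<exists>L. \<forall>s t. \<bar>F \<phi> s - F \<phi> t\<bar> \<le> L * \<bar>s - t\<bar>"
proof -
  obtain C where C: "\<And>t. measure \<nu> (band t (a + 1)) \<le> C" using band_bounded by blast
  obtain K where K: "\<And>t. \<bar>F \<phi> t\<bar> \<le> K" using F_bounded by blast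
  have l: "0 \<le> l" using lip[of 1 0] by simp
  have C0: "0 \<le> C" using C[of 0] measure_nonneg order_trans by blast
  have K0: "0 \<le> K" using K[of 0] by linarith
  have "\<bar>F \<phi> s - F \<phi> t\<bar> \<le> (l * C + 2 * K) * \<bar>s - t\<bar>" for s t
  proof (cases "\<bar>s - t\<bar> \<le> 1")
    case True
    have "\<bar>F \<phi> s - F \<phi> t\<bar> = \<bar>\<integral>x. (if 0 < x then \<phi> (poslog x - s) else 0) - (if 0 < x then \<phi> (poslog x - t) else 0) \<partial>\<nu>\<bar>"
      unfolding F_def using F_integrable by simp
    also have "\<dots> \<le> (\<integral>x. \<bar>(if 0 < x then \<phi> (poslog x - s) else 0) - (if 0 < x then \<phi> (poslog x - t) else 0)\<bar> \<partial>\<nu>)"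
      by (rule integral_abs_bound)
    also have "\<dots> \<le> (\<integral>x. (l * \<bar>s - t\<bar>) * indicator (band t (a + 1)) x \<partial>\<nu>)"
    proof (rule integral_mono'[OF band_indicator_integral(1)])
      fix x
      show "\<bar>(if 0 < x then \<phi> (poslog x - s) else 0) - (if 0 < x then \<phi> (poslog x - t) else 0)\<bar> \<le> (l * \<bar>s - t\<bar>) * indicator (band t (a + 1)) x"
      proof (cases "x \<in> band t (a + 1)")
        case True
        then show ?thesis using lip[of "poslog x - s" "poslog x - t"] by (simp add: band_def abs_minus_commute)
      next
        case False
        then have "\<not> \<bar>poslog x - s\<bar> \<le> a" "\<not> \<bar>poslog x - t\<bar> \<le> a" if "0 < x"
          using that True unfolding band_def mem_Collect_eq by linarith+
        then have "\<phi> (poslog x - s) = 0 \<and> \<phi> (poslog x - t) = 0" if "0 < x"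
          using that supp by blast
        then show ?thesis using False by simp
      qed
    qed (use l in auto)
    also have "\<dots> \<le> (l * \<bar>s - t\<bar>) * C" unfolding band_indicator_integral(2) using C l by (intro mult_left_mono) auto
    also have "\<dots> \<le> (l * C + 2 * K) * \<bar>s - t\<bar>" using K0 by (simp add: algebra_simps)
    finally show ?thesis .
  next
    case False
    have "\<bar>F \<phi> s - F \<phi> t\<bar> \<le> 2 * K" using K[of s] K[of t] by linarith
    also have "\<dots> \<le> (l * C + 2 * K) * 1" using l C0 by simp
    also have "\<dots> \<le> (l * C + 2 * K) * \<bar>s - t\<bar>" using False l C0 K0 by (intro mult_left_mono) auto
    finally show ?thesis .
  qed
  then show ?thesis by blast
qed

text \<open>For large \<open>t\<close> the difference is the integral of the defect of the
  translated bump. It tends to 0 because the bump leaves every bounded region while its Lipschitz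
  constant stays fixed.\<close>

lemma F_harmonic: "((\<lambda>t. F \<phi> t - expectation (\<lambda>\<omega>. F \<phi> (t - \<xi> \<omega>))) \<longlongrightarrow> 0) at_top"
proof (rule Lim_transform_eventually)
  have ev0: "eventually (\<lambda>t. \<phi> (s - t) = 0) at_top" for s
    using eventually_gt_at_top[of "s + \<bar>a\<bar>"] 
  proof eventually_elim
    case (elim t)
    then show ?case using supp[of "s - t"] by linarith
  qed
  have "((\<lambda>t. \<integral>p. defect (\<lambda>s. \<phi> (s - t)) p \<partial>Q) \<longlongrightarrow> (\<integral>p. defect (\<lambda>s. 0) p \<partial>Q)) at_top"
  proof (rule defect_integral_tendsto[where l=l])
    show "\<bar>\<phi> (r - t) - \<phi> (s - t)\<bar> \<le> l * \<bar>r - s\<bar>" for t r s using lip[of "r - t" "s - t"] by simp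
    show "eventually (\<lambda>t. \<phi> (0 - t) = 0) at_top" by (rule ev0)
    show "((\<lambda>t. \<phi> (s - t)) \<longlongrightarrow> 0) at_top" for s by (rule tendsto_eventually[OF ev0])
  qed auto
  then show "((\<lambda>t. \<integral>p. defect (\<lambda>s. \<phi> (s - t)) p \<partial>Q) \<longlongrightarrow> 0) at_top" by (simp add: defect_def)
  show "eventually (\<lambda>t. (\<integral>p. defect (\<lambda>s. \<phi> (s - t)) p \<partial>Q) = F \<phi> t - expectation (\<lambda>\<omega>. F \<phi> (t - \<xi> \<omega>))) at_top"
    using ev0[of 0]
  proof eventually_elim
    case (elim t)
    let ?f = "\<lambda>x. if 0 < x then \<phi> (poslog x - t) else 0"
    define g where "g p = (if 0 < snd p then \<phi> (walk p - t) else 0)" for p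
    have split: "defect (\<lambda>s. \<phi> (s - t)) p = ?f (Y p) - g p" for p
      using elim by (simp add: defect_def g_def)
    have d_int: "integrable Q (defect (\<lambda>s. \<phi> (s - t)))"
    proof (rule defect_integrable[where l=l])
      show "\<bar>\<phi> (r - t) - \<phi> (s - t)\<bar> \<le> l * \<bar>r - s\<bar>" for r s using lip[of "r - t" "s - t"] by simp
    qed (use elim in auto)
    have f_int: "integrable Q (\<lambda>p. ?f (Y p))" "(\<integral>p. ?f (Y p) \<partial>Q) = F \<phi> t"
      using integrable_Y[OF F_integrable[of t]] integral_Y[OF F_integrable[of t]] by (auto simp: F_def)
    have g_eq: "g = (\<lambda>p. ?f (Y p) - defect (\<lambda>s. \<phi> (s - t)) p)" using split by (simp add: fun_eq_iff)
    have g_int: "integrable Q g" unfolding g_eq using f_int(1) d_int by simp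
    have inner: "(\<integral>x. g (\<omega>, x) \<partial>\<nu>) = F \<phi> (t - \<xi> \<omega>)" for \<omega>
      unfolding F_def by (intro Bochner_Integration.integral_cong) (auto simp: g_def walk_def algebra_simps)
    have "(\<integral>p. g p \<partial>Q) = expectation (\<lambda>\<omega>. F \<phi> (t - \<xi> \<omega>))"
      using integral_fst'[OF g_int] unfolding inner by simp
    then show ?case unfolding split using f_int g_int by simp
  qed
qed

text \<open>The admissible shifts form a closed additive set, and by the maximum principle it
  contains the support of the law of \<open>\<xi>\<close>.\<close>

lemma F_shift: "((\<lambda>t. F \<phi> (t - u) - F \<phi> t) \<longlongrightarrow> 0) at_top"
proof -
  obtain K where K: "\<And>t. \<bar>F \<phi> t\<bar> \<le> K" using F_bounded by blast
  obtain L where L: "\<And>s t. \<bar>F \<phi> s - F \<phi> t\<bar> \<le> L * \<bar>s - t\<bar>" using F_lipschitz by blast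
  define H where "H = {y. ((\<lambda>t. F \<phi> (t - y) - F \<phi> t) \<longlongrightarrow> 0) at_top}"
  have "H = UNIV"
  proof (rule aperiodic)
    show "closed H" "\<And>y z. y \<in> H \<Longrightarrow> z \<in> H \<Longrightarrow> y + z \<in> H" 
      unfolding H_def by (rule shift_all_tendsto_0[OF L], assumption?)+
    show "y \<in> H" if "\<And>r. 0 < r \<Longrightarrow> 0 < prob {\<omega> \<in> space M. \<bar>\<xi> \<omega> - y\<bar> < r}" for y
      unfolding H_def mem_Collect_eq
      by (rule shift_tendsto_0[where \<xi>=\<xi>, OF _ _ K L F_harmonic that]) auto
  qed
  then show ?thesis by (auto simp: H_def)
qed

text \<open>By Tonelli the convolution of \<open>F \<phi>\<close> with \<open>k\<close> equals the
  average of \<open>G (t + v)\<close> with weight \<open>\<phi> v\<close>, and \<open>G\<close>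
  converges boundedly.\<close>

lemma F_conv_k_tendsto: "((\<lambda>t. \<integral>u. F \<phi> (t - u) * k u \<partial>lborel) \<longlongrightarrow> b * (\<integral>v. \<phi> v \<partial>lborel)) at_top"
proof (rule Lim_transform_eventually)
  have phi_int: "integrable lborel \<phi>"
  proof (rule Bochner_Integration.integrable_bound)
    show "integrable lborel (\<lambda>v. c * indicator {-a..a} v)"
      by (intro integrable_mult_right integrable_real_indicator) (auto simp: emeasure_lborel_Icc_eq)
    show "AE v in lborel. norm (\<phi> v) \<le> norm (c * indicator {-a..a} v)"
    proof (rule AE_I2)
      fix v show "norm (\<phi> v) \<le> norm (c * indicator {-a..a} v)"
        using supp[of v] bdd[of v] by (cases "\<phi> v = 0") (auto simp: indicator_def abs_le_iff)
    qed
  qed simp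
  have [measurable]: "G \<in> borel_measurable borel" unfolding G_def[abs_def] by measurable
  have Gmax0: "0 \<le> Gmax" using G_le[of 0] G_nonneg[of 0] by simp
  \<comment> \<open>On the support of \<open>\<phi>\<close> this keeps \<open>t + v\<close> in the
    range where \<open>G\<close> is known to be bounded and its integrand integrable.\<close>
  have pos: "0 \<le> t + v" if "\<bar>a\<bar> \<le> t" "\<phi> v \<noteq> 0" for t v using supp[OF that(2)] that(1) by linarith
  have "((\<lambda>t. \<integral>v. \<phi> v * G (t + v) \<partial>lborel) \<longlongrightarrow> (\<integral>v. \<phi> v * b \<partial>lborel)) at_top"
  proof (rule integral_dominated_convergence_at_top[where w="\<lambda>v. Gmax * \<phi> v"])
    show "integrable lborel (\<lambda>v. Gmax * \<phi> v)" using phi_int by simp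
    show "eventually (\<lambda>t. AE v in lborel. norm (\<phi> v * G (t + v)) \<le> Gmax * \<phi> v) at_top"
      using eventually_ge_at_top[of "\<bar>a\<bar>"]
    proof eventually_elim
      case (elim t)
      show ?case
      proof (rule AE_I2)
        fix v show "norm (\<phi> v * G (t + v)) \<le> Gmax * \<phi> v"
          using pos[OF elim, of v] G_le[of "t + v"] G_nonneg[of "t + v"] bdd(1)[of v]
          by (cases "\<phi> v = 0") (auto simp: abs_mult mult.commute[of _ "\<phi> v"] intro!: mult_left_mono)
      qed
    qed
    show "AE v in lborel. ((\<lambda>t. \<phi> v * G (t + v)) \<longlongrightarrow> \<phi> v * b) at_top"
    proof (rule AE_I2)
      fix v :: real
      have "filterlim (\<lambda>t. t + v :: real) at_top at_top"
        using filterlim_tendsto_add_at_top[OF tendsto_const[of v] filterlim_ident] by (simp add: add.commute)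
      from filterlim_compose[OF G_tendsto this] show "((\<lambda>t. \<phi> v * G (t + v)) \<longlongrightarrow> \<phi> v * b) at_top"
        by (intro tendsto_mult tendsto_const)
    qed
  qed measurable
  then show "((\<lambda>t. \<integral>v. \<phi> v * G (t + v) \<partial>lborel) \<longlongrightarrow> b * (\<integral>v. \<phi> v \<partial>lborel)) at_top"
    by (simp add: mult.commute)
  show "eventually (\<lambda>t. (\<integral>v. \<phi> v * G (t + v) \<partial>lborel) = (\<integral>u. F \<phi> (t - u) * k u \<partial>lborel)) at_top"
    using eventually_ge_at_top[of "\<bar>a\<bar>"]
  proof eventually_elim
    case (elim t)
    interpret ln: pair_sigma_finite lborel \<nu> ..
    have "(\<integral>\<^sup>+ u. ennreal (F \<phi> (t - u) * k u) \<partial>lborel)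
      = (\<integral>\<^sup>+ u. (\<integral>\<^sup>+ x. ennreal ((if 0 < x then \<phi> (poslog x - (t - u)) else 0) * k u) \<partial>\<nu>) \<partial>lborel)"
    proof (rule nn_integral_cong)
      fix u
      show "ennreal (F \<phi> (t - u) * k u) = (\<integral>\<^sup>+ x. ennreal ((if 0 < x then \<phi> (poslog x - (t - u)) else 0) * k u) \<partial>\<nu>)"
        using F_integrable[of "t - u"] unfolding F_def
        by (subst nn_integral_eq_integral) (auto simp: bdd k_nonneg)
    qed
    also have "\<dots> = (\<integral>\<^sup>+ x. (\<integral>\<^sup>+ u. ennreal ((if 0 < x then \<phi> (poslog x - (t - u)) else 0) * k u) \<partial>lborel) \<partial>\<nu>)"
      by (rule ln.Fubini'[symmetric]) measurable
    also have "\<dots> = (\<integral>\<^sup>+ x. (\<integral>\<^sup>+ v. ennreal (\<phi> v * (if 0 < x then k (t + v - poslog x) else 0)) \<partial>lborel) \<partial>\<nu>)"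
    proof (rule nn_integral_cong)
      fix x
      \<comment> \<open>The substitution \<open>u = (t - poslog x) + v\<close> makes the argument of
        \<open>\<phi>\<close> equal to \<open>v\<close> and moves the dependence on \<open>x\<close>
        into \<open>k\<close>.\<close>
      have "(\<integral>\<^sup>+ u. ennreal ((if 0 < x then \<phi> (poslog x - (t - u)) else 0) * k u) \<partial>lborel)
        = (\<integral>\<^sup>+ v. ennreal ((if 0 < x then \<phi> (poslog x - (t - ((t - poslog x) + 1 * v))) else 0) * k ((t - poslog x) + 1 * v)) \<partial>lborel)"
        by (subst nn_integral_real_affine[of _ 1 "t - poslog x"]) auto
      also have "\<dots> = (\<integral>\<^sup>+ v. ennreal (\<phi> v * (if 0 < x then k (t + v - poslog x) else 0)) \<partial>lborel)"
        by (intro nn_integral_cong) (auto simp: algebra_simps)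
      finally show "(\<integral>\<^sup>+ u. ennreal ((if 0 < x then \<phi> (poslog x - (t - u)) else 0) * k u) \<partial>lborel) = \<dots>" .
    qed
    also have "\<dots> = (\<integral>\<^sup>+ v. (\<integral>\<^sup>+ x. ennreal (\<phi> v * (if 0 < x then k (t + v - poslog x) else 0)) \<partial>\<nu>) \<partial>lborel)"
      by (rule ln.Fubini') measurable
    also have "\<dots> = (\<integral>\<^sup>+ v. ennreal (\<phi> v * G (t + v)) \<partial>lborel)"
    proof (rule nn_integral_cong)
      fix v
      show "(\<integral>\<^sup>+ x. ennreal (\<phi> v * (if 0 < x then k (t + v - poslog x) else 0)) \<partial>\<nu>) = ennreal (\<phi> v * G (t + v))"
      proof (cases "\<phi> v = 0")
        case False
        then have "0 \<le> t + v" using pos[OF elim] by blast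
        from G_eq_defect(1)[OF this] show ?thesis unfolding G_def
          by (subst nn_integral_eq_integral) (auto simp: bdd k_nonneg intro!: integrable_mult_right)
      qed simp
    qed
    finally have "(\<integral>\<^sup>+ u. ennreal (F \<phi> (t - u) * k u) \<partial>lborel) = (\<integral>\<^sup>+ v. ennreal (\<phi> v * G (t + v)) \<partial>lborel)" .
    then show ?case
      by (subst (1 2) integral_eq_nn_integral) (auto simp: bdd G_nonneg F_nonneg k_nonneg)
  qed
qed

text \<open>Asymptotic shift invariance and dominated convergence against \<open>k\<close> allow
  \<open>F \<phi> (t - u)\<close> to be replaced by \<open>F \<phi> t\<close> in the convolution; it
  remains to divide by the integral of \<open>k\<close>.\<close>

lemma F_tendsto: "(F \<phi> \<longlongrightarrow> b / (\<integral>u. k u \<partial>lborel) * (\<integral>v. \<phi> v \<partial>lborel)) at_top"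
proof -
  let ?k = "\<integral>u. k u \<partial>lborel"
  obtain K where K: "\<And>t. \<bar>F \<phi> t\<bar> \<le> K" using F_bounded by blast
  have int: "integrable lborel (\<lambda>u. F \<phi> (t - u) * k u)" for t
  proof (rule Bochner_Integration.integrable_bound)
    show "integrable lborel (\<lambda>u. K * k u)" using k_integrable by simp
    show "AE u in lborel. norm (F \<phi> (t - u) * k u) \<le> norm (K * k u)"
      using order_trans[OF K abs_ge_self] by (auto simp: abs_mult intro!: mult_right_mono)
  qed simp
  have "((\<lambda>t. \<integral>u. (F \<phi> (t - u) - F \<phi> t) * k u \<partial>lborel) \<longlongrightarrow> (\<integral>u. 0 \<partial>(lborel :: real measure))) at_top"
  proof (rule integral_dominated_convergence_at_top[where w="\<lambda>u. 2 * K * k u"])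
    show "integrable lborel (\<lambda>u. 2 * K * k u)" using k_integrable by simp
    show "eventually (\<lambda>t. AE u in lborel. norm ((F \<phi> (t - u) - F \<phi> t) * k u) \<le> 2 * K * k u) at_top"
    proof (intro always_eventually allI AE_I2)
      fix t u
      have "\<bar>F \<phi> (t - u) - F \<phi> t\<bar> \<le> 2 * K" using K[of "t - u"] K[of t] by linarith
      then show "norm ((F \<phi> (t - u) - F \<phi> t) * k u) \<le> 2 * K * k u" 
        using k_nonneg[of u] by (auto simp: abs_mult intro!: mult_right_mono)
    qed
    show "AE u in lborel. ((\<lambda>t. (F \<phi> (t - u) - F \<phi> t) * k u) \<longlongrightarrow> 0) at_top"
      using tendsto_mult_right[OF F_shift] by auto
  qed measurable
  then have lim0: "((\<lambda>t. (\<integral>u. F \<phi> (t - u) * k u \<partial>lborel) - F \<phi> t * ?k) \<longlongrightarrow> 0) at_top"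
    using int k_integrable by (simp add: left_diff_distrib)
  have "((\<lambda>t. ((\<integral>u. F \<phi> (t - u) * k u \<partial>lborel) - ((\<integral>u. F \<phi> (t - u) * k u \<partial>lborel) - F \<phi> t * ?k)) / ?k)
      \<longlongrightarrow> (b * (\<integral>v. \<phi> v \<partial>lborel) - 0) / ?k) at_top"
    using k_integral_pos by (intro tendsto_divide tendsto_diff F_conv_k_tendsto lim0 tendsto_const) auto
  then show ?thesis using k_integral_pos by simp
qed

end

section \<open>From test functions to intervals\<close>

definition C_lim :: real where "C_lim = b / (\<integral>u. k u \<partial>lborel)"

lemma C_lim_nonneg: "0 \<le> C_lim"
  using b_nonneg k_integral_pos by (simp add: C_lim_def)

lemma F_trap:
  assumes "0 < d"
  shows "(F (trap d p q) \<longlongrightarrow> C_lim * (\<integral>v. trap d p q v \<partial>lborel)) at_top"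
    and "integrable \<nu> (\<lambda>x. if 0 < x then trap d p q (poslog x - t) else 0)"
proof -
  have lip: "\<bar>trap d p q s - trap d p q t\<bar> \<le> (1 / d) * \<bar>s - t\<bar>" for s t by (rule trap_lipschitz[OF assms])
  have supp: "trap d p q s \<noteq> 0 \<Longrightarrow> \<bar>s\<bar> \<le> \<bar>p\<bar> + \<bar>q\<bar>" for s using trap_support[OF assms, of p q s] by linarith
  show "(F (trap d p q) \<longlongrightarrow> C_lim * (\<integral>v. trap d p q v \<partial>lborel)) at_top"
    unfolding C_lim_def by (rule F_tendsto[OF trap_measurable lip supp trap_bounds])
  show "integrable \<nu> (\<lambda>x. if 0 < x then trap d p q (poslog x - t) else 0)"
    by (rule F_integrable[OF trap_measurable lip supp trap_bounds])
qed

text \<open>Allowing any set between the open and the closed interval covers both half-open forms,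
  since reflection exchanges the included end. In the coordinate \<open>poslog\<close>,
  \<open>S x\<close> is nearly the window from \<open>ln \<alpha>\<close> to
  \<open>ln \<beta>\<close> shifted by \<open>ln x\<close>, and it is squeezed between two
  trapezoids.\<close>

lemma interval_limit:
  fixes S :: "real \<Rightarrow> real set"
  assumes ab: "0 < \<alpha>" "\<alpha> < \<beta>"
    and S: "\<And>x. 0 < x \<Longrightarrow> S x \<in> sets borel" 
      "\<And>x. 0 < x \<Longrightarrow> {\<alpha> * x<..<\<beta> * x} \<subseteq> S x" "\<And>x. 0 < x \<Longrightarrow> S x \<subseteq> {\<alpha> * x..\<beta> * x}"
  shows "((\<lambda>x. measure \<nu> (S x)) \<longlongrightarrow> ln (\<beta> / \<alpha>) * C_lim) at_top"
proof (rule tendstoI)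
  fix e :: real assume e: "0 < e"
  define P where "P = ln \<alpha>"
  define R where "R = ln \<beta>"
  have PR: "P < R" "ln (\<beta> / \<alpha>) = R - P" using ab by (auto simp: P_def R_def ln_div)
  \<comment> \<open>The trapezoid integrals miss \<open>R - P\<close> by at most
    \<open>3 * d\<close>, which costs less than \<open>3 * e / 4\<close>; the remaining
    \<open>e / 4\<close> is left for the convergence of \<open>F\<close>.\<close>
  define d where "d = e / (4 * C_lim + 4)"
  have d: "0 < d" "4 * d * C_lim < e" using e C_lim_nonneg by (auto simp: d_def field_simps add_pos_nonneg)
  have poslog_upper: "poslog (\<gamma> * x) \<le> ln \<gamma> + ln x + 1 / (\<gamma> * x)" if "0 < \<gamma>" "0 < x" for \<gamma> x
  proof -
    have "ln (1 + \<gamma> * x) - ln (\<gamma> * x) \<le> 1 / (\<gamma> * x)" using that by (intro ln_ratio_le) (auto intro: add_pos_pos)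
    then show ?thesis using that by (simp add: poslog_def ln_mult_pos max_def mult_less_0_iff)
  qed
  have poslog_lower: "ln \<gamma> + ln x \<le> poslog (\<gamma> * x)" if "0 < \<gamma>" "0 < x" for \<gamma> x
  proof -
    have "0 < \<gamma> * x" using that by simp
    then have "ln (\<gamma> * x) \<le> ln (1 + \<gamma> * x)" by (subst ln_le_cancel_iff) auto
    then show ?thesis using that by (simp add: poslog_def max_def mult_less_0_iff ln_mult_pos)
  qed
  have poslog_mono: "poslog y \<le> poslog z" if "y \<le> z" for y z
    using that by (auto simp: poslog_def max_def)
  have small: "eventually (\<lambda>x. 1 / (\<alpha> * x) < d) at_top"
    using eventually_gt_at_top[of "max 0 (1 / (\<alpha> * d))"]
  proof eventually_elim
    case (elim x)
    then have "1 < x * (\<alpha> * d)" using ab d by (simp add: pos_divide_less_eq)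
    then show ?case using elim ab by (simp add: pos_divide_less_eq mult_ac)
  qed
  have lnx: "filterlim (\<lambda>x::real. ln x) at_top at_top" by (rule ln_at_top)
  have S_fin: "S x \<in> fmeasurable \<nu>" if x: "0 < x" for x
  proof (rule finite_on_bounded)
    show "\<bar>y\<bar> \<le> \<beta> * x" if "y \<in> S x" for y
      using S(3)[OF x] that mult_pos_pos[OF ab(1) x] by force
  qed (rule S(1)[OF x])
  have S_int: "integrable \<nu> (\<lambda>y. indicator (S x) y :: real)" "(\<integral>y. indicator (S x) y \<partial>\<nu>) = measure \<nu> (S x)" if "0 < x" for x
    using S_fin[OF that] by (auto simp: fmeasurable_def)
  \<comment> \<open>\<open>?U\<close> equals 1 from \<open>P\<close> to \<open>R + d\<close>, and
    \<open>?W\<close> lives between \<open>P + d\<close> and \<open>R\<close>. The extra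
    \<open>d\<close> in each absorbs the excess of \<open>poslog\<close> over the logarithm.\<close>
  let ?U = "trap d (P - d) (R + 2 * d)" and ?W = "trap d (P + d) R"
  have U: "(\<integral>v. ?U v \<partial>lborel) \<le> R - P + 3 * d" using trap_integral(1)[OF d(1), of "P - d" "R + 2 * d"] PR d by simp
  have W: "R - P - 3 * d \<le> (\<integral>v. ?W v \<partial>lborel)" using trap_integral(2)[OF d(1), of R "P + d"] by simp
  have evU: "eventually (\<lambda>x. dist (F ?U (ln x)) (C_lim * (\<integral>v. ?U v \<partial>lborel)) < e / 4) at_top"
    using e by (intro tendstoD[OF filterlim_compose[OF F_trap(1)[OF d(1)] lnx]]) simp
  have evW: "eventually (\<lambda>x. dist (F ?W (ln x)) (C_lim * (\<integral>v. ?W v \<partial>lborel)) < e / 4) at_top"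
    using e by (intro tendstoD[OF filterlim_compose[OF F_trap(1)[OF d(1)] lnx]]) simp
  show "eventually (\<lambda>x. dist (measure \<nu> (S x)) (ln (\<beta> / \<alpha>) * C_lim) < e) at_top"
    using small evU evW eventually_gt_at_top[of 0]
  proof eventually_elim
    case (elim x)
    note x = elim(4)
    have ax: "0 < \<alpha> * x" "\<alpha> * x < \<beta> * x" using ab x by auto
    have "measure \<nu> (S x) = (\<integral>y. indicator (S x) y \<partial>\<nu>)" using S_int[OF x] by simp
    also have "\<dots> \<le> F ?U (ln x)" unfolding F_def
    proof (rule integral_mono[OF S_int(1)[OF x] F_trap(2)[OF d(1)]])
      fix y
      show "indicator (S x) y \<le> (if 0 < y then ?U (poslog y - ln x) else 0)"
      proof (cases "y \<in> S x")
        case True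
        then have y: "\<alpha> * x \<le> y" "y \<le> \<beta> * x" using S(3)[OF x] by auto
        have "1 / (\<beta> * x) \<le> 1 / (\<alpha> * x)" using ax by (intro divide_left_mono) (auto intro!: mult_pos_pos)
        then have "poslog y - ln x \<le> R + d"
          using poslog_mono[OF y(2)] poslog_upper[of \<beta> x] ab x elim(1) by (simp add: R_def)
        moreover have "P \<le> poslog y - ln x" using poslog_mono[OF y(1)] poslog_lower[of \<alpha> x] ab x by (simp add: P_def)
        ultimately have "?U (poslog y - ln x) = 1" using d by (intro trap_eq_1) auto
        then show ?thesis using True y ax by simp
      qed (simp add: trap_bounds)
    qed
    finally have up: "measure \<nu> (S x) \<le> F ?U (ln x)" .
    have "F ?W (ln x) \<le> (\<integral>y. indicator (S x) y \<partial>\<nu>)" unfolding F_def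
    proof (rule integral_mono[OF F_trap(2)[OF d(1)] S_int(1)[OF x]])
      fix y
      show "(if 0 < y then ?W (poslog y - ln x) else 0) \<le> indicator (S x) y"
      proof (cases "?W (poslog y - ln x) = 0")
        case False
        then have v: "P + d < poslog y - ln x" "poslog y - ln x < R" using trap_support[OF d(1)] by auto
        have "poslog y < poslog (\<beta> * x)" using v poslog_lower[of \<beta> x] ab x by (simp add: R_def)
        then have "y < \<beta> * x" using poslog_mono[of "\<beta> * x" y] by linarith
        moreover have "poslog (\<alpha> * x) < poslog y" using v poslog_upper[of \<alpha> x] ab x elim(1) by (simp add: P_def)
        then have "\<alpha> * x < y" using poslog_mono[of y "\<alpha> * x"] by linarith
        ultimately have "y \<in> S x" using S(2)[OF x] by auto
        then show ?thesis using trap_bounds by simp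
      qed simp
    qed
    then have lo: "F ?W (ln x) \<le> measure \<nu> (S x)" using S_int[OF x] by simp
    have "C_lim * (\<integral>v. ?U v \<partial>lborel) \<le> (R - P) * C_lim + 3 * (d * C_lim)"
      using mult_left_mono[OF U C_lim_nonneg] by (simp add: distrib_left mult_ac)
    moreover have "(R - P) * C_lim - 3 * (d * C_lim) \<le> C_lim * (\<integral>v. ?W v \<partial>lborel)"
      using mult_left_mono[OF W C_lim_nonneg] by (simp add: right_diff_distrib left_diff_distrib mult_ac)
    moreover have "4 * (d * C_lim) < e" using d(2) by (simp add: mult.assoc)
    ultimately have "\<bar>measure \<nu> (S x) - (R - P) * C_lim\<bar> < e"
      using up lo elim(2,3) unfolding dist_real_def by linarith
    then show ?case unfolding dist_real_def PR(2) .
  qed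
qed

end

section \<open>Moment bounds and the group hypothesis\<close>

lemma power_le_exp:
  fixes x c :: real assumes "0 \<le> x" "0 < c" shows "x ^ 4 \<le> (4 / c) ^ 4 * exp (c * x)"
proof -
  have "c * x / 4 \<le> exp (c * x / 4)" using exp_ge_add_one_self[of "c * x / 4"] by linarith
  then have "(c * x / 4) ^ 4 \<le> exp (c * x / 4) ^ 4" using assms by (intro power_mono) auto
  also have "\<dots> = exp (c * x)" by (simp flip: exp_of_nat_mult)
  finally have "(4 / c) ^ 4 * (c * x / 4) ^ 4 \<le> (4 / c) ^ 4 * exp (c * x)" using assms by (intro mult_left_mono) auto
  moreover have "(4 / c) ^ 4 * (c * x / 4) ^ 4 = x ^ 4" using assms unfolding power_mult_distrib[symmetric] by simp
  ultimately show ?thesis by simp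
qed

text \<open>Fourth powers of logarithms are dominated by small exponentials of them, that is, by the
  powers \<open>a powr \<delta>\<close>, \<open>a powr (- \<delta>)\<close> and
  \<open>\<bar>b\<bar> powr \<delta>\<close>.\<close>

lemma cost_power_le:
  assumes "0 < a" "0 < \<delta>"
  defines "c \<equiv> 27 * (4 / \<delta>) ^ 4"
  shows "cost a b ^ 4 \<le> 27 + c * (a powr \<delta> + a powr (- \<delta>)) + c * (2 powr \<delta> * (1 + \<bar>b\<bar> powr \<delta>))"
proof -
  define u where "u = \<bar>ln a\<bar>"
  define v where "v = ln (1 + \<bar>b\<bar>)"
  have uv: "0 \<le> u" "0 \<le> v" by (simp_all add: u_def v_def)
  \<comment> \<open>The inequality for squares of three summands is used twice:
    \<open>27 = 3\<^sup>2 * 3\<close>.\<close>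
  have pow: "(1 + u + v) ^ 4 \<le> 27 * (1 + u ^ 4 + v ^ 4)"
  proof -
    have sq: "(x + y + z)\<^sup>2 \<le> 3 * (x\<^sup>2 + y\<^sup>2 + z\<^sup>2)" for x y z :: real
      using zero_le_power2[of "x - y"] zero_le_power2[of "y - z"] zero_le_power2[of "x - z"]
      by (simp add: power2_eq_square algebra_simps)
    have "(1 + u + v) ^ 4 = ((1 + u + v)\<^sup>2)\<^sup>2" by simp
    also have "\<dots> \<le> (3 * (1\<^sup>2 + u\<^sup>2 + v\<^sup>2))\<^sup>2" by (intro power_mono sq) simp
    also have "\<dots> = 9 * (1\<^sup>2 + u\<^sup>2 + v\<^sup>2)\<^sup>2" by (simp only: power_mult_distrib) simp
    also have "\<dots> \<le> 9 * (3 * ((1\<^sup>2)\<^sup>2 + (u\<^sup>2)\<^sup>2 + (v\<^sup>2)\<^sup>2))" by (intro mult_left_mono sq) simp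
    finally show ?thesis by simp
  qed
  have eu: "exp (\<delta> * u) \<le> a powr \<delta> + a powr (- \<delta>)"
    using assms by (cases "0 \<le> ln a") (auto simp: u_def powr_def)
  have ev: "exp (\<delta> * v) \<le> 2 powr \<delta> * (1 + \<bar>b\<bar> powr \<delta>)"
  proof -
    have "exp (\<delta> * v) = (1 + \<bar>b\<bar>) powr \<delta>" by (simp add: v_def powr_def add_pos_nonneg)
    also have "\<dots> \<le> (2 * max 1 \<bar>b\<bar>) powr \<delta>" using assms by (intro powr_mono2) auto
    also have "\<dots> = 2 powr \<delta> * max 1 \<bar>b\<bar> powr \<delta>" by (simp add: powr_mult)
    also have "\<dots> \<le> 2 powr \<delta> * (1 + \<bar>b\<bar> powr \<delta>)" by (intro mult_left_mono) (auto simp: max_def)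
    finally show ?thesis .
  qed
  define K where "K = (4 / \<delta>) ^ 4"
  have K: "0 \<le> K" "c = 27 * K" using assms by (simp_all add: K_def)
  have "u ^ 4 \<le> K * (a powr \<delta> + a powr (- \<delta>))"
    using order_trans[OF power_le_exp[OF uv(1) assms(2)] mult_left_mono[OF eu K(1)[unfolded K_def]]] unfolding K_def .
  moreover have "v ^ 4 \<le> K * (2 powr \<delta> * (1 + \<bar>b\<bar> powr \<delta>))"
    using order_trans[OF power_le_exp[OF uv(2) assms(2)] mult_left_mono[OF ev K(1)[unfolded K_def]]] unfolding K_def .
  ultimately have "27 * (1 + u ^ 4 + v ^ 4) \<le> 27 + c * (a powr \<delta> + a powr (- \<delta>)) + c * (2 powr \<delta> * (1 + \<bar>b\<bar> powr \<delta>))"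
    unfolding K(2) by (simp add: distrib_left mult.assoc)
  with pow show ?thesis by (simp add: cost_def u_def v_def)
qed

text \<open>The map sending \<open>g\<close> to \<open>ln (snd g)\<close> is a continuous
  homomorphism onto the additive reals. The preimage of \<open>H\<close> is thus a closed
  subsemigroup containing the support, hence the whole group.\<close>

lemma closed_additive_set_eq_UNIV:
  assumes hull: "closed_subsemigroup hull measure_support m = affine_group"
    and H: "closed H" "\<And>y z. \<lbrakk>y \<in> H; z \<in> H\<rbrakk> \<Longrightarrow> y + z \<in> H"
    and supp: "\<And>g. g \<in> measure_support m \<Longrightarrow> g \<in> affine_group \<Longrightarrow> ln (snd g) \<in> H"
  shows "H = UNIV"
proof -
  define T where "T = {g \<in> affine_group. ln (snd g) \<in> H}"
  have "closed_subsemigroup T"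
    unfolding closed_subsemigroup_def
  proof (intro conjI ballI)
    have "continuous_on affine_group (\<lambda>g. ln (snd g))"
      by (intro continuous_intros) (auto simp: affine_group_def)
    from continuous_closedin_preimage[OF this H(1)]
    moreover have "T = affine_group \<inter> (\<lambda>g. ln (snd g)) -` H" by (auto simp: T_def)
    ultimately show "closedin (top_of_set affine_group) T" by (simp only:)
    fix g h assume "g \<in> T" "h \<in> T"
    then have gh: "0 < snd g" "0 < snd h" "ln (snd g) \<in> H" "ln (snd h) \<in> H"
      by (auto simp: T_def affine_group_def)
    then show "affine_mult g h \<in> T"
      using H(2)[OF gh(3,4)] by (simp add: T_def affine_group_def affine_mult_def ln_mult_pos)
  qed
  moreover have sub: "measure_support m \<subseteq> T"
  proof
    fix g assume g: "g \<in> measure_support m"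
    then have "g \<in> closed_subsemigroup hull measure_support m" by (rule subsetD[OF hull_subset])
    then have "g \<in> affine_group" using hull by simp
    with supp g show "g \<in> T" by (simp add: T_def)
  qed
  ultimately have "affine_group \<subseteq> T"
    using hull_minimal[of "measure_support m" T closed_subsemigroup] hull by simp
  then have "(0, exp y) \<in> T" for y by (auto simp: affine_group_def)
  then have "ln (snd (0::real, exp y)) \<in> H" for y :: real unfolding T_def by blast
  then show ?thesis by auto
qed


section \<open>Reflection and the final reduction\<close>

text \<open>Conjugating \<open>x \<mapsto> A x + B\<close> by the reflection about 0 changes the
  sign of \<open>B\<close> and leaves \<open>A\<close> alone, so all conditions on
  \<open>ln A\<close> persist.\<close>

lemma (in critical_affine_recursion) reflected:
  "critical_affine_recursion M A (\<lambda>\<omega>. - B \<omega>) (distr \<nu> borel uminus)"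
proof
  show "integrable M (\<lambda>\<omega>. cost (A \<omega>) (- B \<omega>) ^ 4)" using cost_integrable by (simp add: cost_def)
  show "emeasure (distr \<nu> borel uminus) K < \<infinity>" if "compact K" for K :: "real set"
  proof -
    have "uminus -` K = uminus ` K" by (auto simp: image_iff) (metis minus_minus)
    then have "compact (uminus -` K)" using that by (simp add: compact_negations)
    moreover have "uminus \<in> borel_measurable \<nu>" by measurable
    ultimately show ?thesis
      using finite_on_compact borel_closed[OF compact_imp_closed[OF that]] by (simp add: emeasure_distr)
  qed
  show "(\<integral>\<^sup>+ \<omega>. (\<integral>\<^sup>+ x. f (A \<omega> * x + - B \<omega>) \<partial>distr \<nu> borel uminus) \<partial>M) = (\<integral>\<^sup>+ x. f x \<partial>distr \<nu> borel uminus)"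
    if [measurable]: "f \<in> borel_measurable borel" for f
    using invariant[of "\<lambda>x. f (- x)"] by (simp add: nn_integral_distr)
qed (use centered nondegenerate aperiodic in auto)

theorem theorem2p2:
  fixes \<mu> :: "(real \<times> real) measure"
    and M :: "'w measure" and A B :: "'w \<Rightarrow> real"
    and \<delta> \<delta>' :: real and \<nu> :: "real measure"
  assumes "prob_space \<mu>" and "sets \<mu> = sets affine_borel"
    and "prob_space M"
    and "(\<lambda>\<omega>. (B \<omega>, A \<omega>)) \<in> measurable M affine_borel"
    and "distr M affine_borel (\<lambda>\<omega>. (B \<omega>, A \<omega>)) = \<mu>"
    and i: "integrable M (\<lambda>\<omega>. ln (A \<omega>))" "(\<integral>\<omega>. ln (A \<omega>) \<partial>M) = 0"
    and ii: "\<not> (AE \<omega> in M. A \<omega> = 1)"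
    and iii: "\<And>x. measure M {\<omega> \<in> space M. A \<omega> * x + B \<omega> = x} < 1"
    and iv: "\<delta>' > 0"
      "integrable M (\<lambda>\<omega>. (\<bar>ln (A \<omega>)\<bar> + ln_plus \<bar>B \<omega>\<bar>) powr (2 + \<delta>'))"
    and v: "closed_subsemigroup hull measure_support \<mu> = affine_group"
    and "\<delta> > 0"
    and vi: "integrable M (\<lambda>\<omega>. A \<omega> powr \<delta>)" "integrable M (\<lambda>\<omega>. A \<omega> powr (- \<delta>))"
    and vii: "integrable M (\<lambda>\<omega>. \<bar>B \<omega>\<bar> powr \<delta>)"
    and viii: "spread_out (distr M pos_borel A)"
    and \<nu>: "invariant_radon_measure \<mu> \<nu>"
  shows "\<exists>C\<^sub>p C\<^sub>m :: real. \<forall>\<alpha> \<beta>. 0 < \<alpha> \<and> \<alpha> < \<beta> \<longrightarrow>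
    ((\<lambda>x. measure \<nu> {\<alpha> * x<..\<beta> * x}) \<longlongrightarrow> ln (\<beta> / \<alpha>) * C\<^sub>p) at_top \<and>
    ((\<lambda>x. measure \<nu> {\<beta> * x<..\<alpha> * x}) \<longlongrightarrow> ln (\<beta> / \<alpha>) * C\<^sub>m) at_bot"
proof -
  interpret M: prob_space M by fact
  let ?g = "\<lambda>\<omega>. (B \<omega>, A \<omega>)"
  have g [measurable]: "?g \<in> borel_measurable M" and g_range: "\<And>\<omega>. \<omega> \<in> space M \<Longrightarrow> ?g \<omega> \<in> affine_group"
    using assms(4) measurable_space[OF assms(4)] by (auto simp: measurable_restrict_space2_iff space_restrict_space)
  have fst_snd [measurable]: "fst \<in> borel_measurable (borel :: (real \<times> real) measure)"
    "snd \<in> borel_measurable (borel :: (real \<times> real) measure)"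
    by (intro borel_measurable_continuous_onI continuous_intros)+
  have A_meas [measurable]: "A \<in> borel_measurable M" and B_meas [measurable]: "B \<in> borel_measurable M"
    using measurable_compose[OF g fst_snd(2)] measurable_compose[OF g fst_snd(1)] by simp_all
  have pos: "0 < A \<omega>" if "\<omega> \<in> space M" for \<omega> using g_range[OF that] by (simp add: affine_group_def)
  \<comment> \<open>Outside \<open>space M\<close> nothing is known about \<open>A\<close>; the
    default 1 makes \<open>A'\<close> positive everywhere, as the locale requires.\<close>
  define A' where "A' \<omega> = (if 0 < A \<omega> then A \<omega> else 1)" for \<omega>
  have A'_pos: "0 < A' \<omega>" for \<omega> by (simp add: A'_def)
  have A'_eq: "A' \<omega> = A \<omega>" if "\<omega> \<in> space M" for \<omega> using pos[OF that] by (simp add: A'_def)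
  have [measurable]: "A' \<in> borel_measurable M" unfolding A'_def[abs_def] by measurable
  have cost_int: "integrable M (\<lambda>\<omega>. cost (A' \<omega>) (B \<omega>) ^ 4)"
  proof (rule Bochner_Integration.integrable_bound)
    define c where "c = 27 * (4 / \<delta>) ^ 4"
    show "integrable M (\<lambda>\<omega>. 27 + c * (A \<omega> powr \<delta> + A \<omega> powr (- \<delta>)) + c * (2 powr \<delta> * (1 + \<bar>B \<omega>\<bar> powr \<delta>)))"
      using vi vii by simp
    show "AE \<omega> in M. norm (cost (A' \<omega>) (B \<omega>) ^ 4)
      \<le> norm (27 + c * (A \<omega> powr \<delta> + A \<omega> powr (- \<delta>)) + c * (2 powr \<delta> * (1 + \<bar>B \<omega>\<bar> powr \<delta>)))"
    proof (rule AE_I2)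
      fix \<omega> assume w: "\<omega> \<in> space M"
      have "cost (A' \<omega>) (B \<omega>) ^ 4 \<le> 27 + c * (A \<omega> powr \<delta> + A \<omega> powr (- \<delta>)) + c * (2 powr \<delta> * (1 + \<bar>B \<omega>\<bar> powr \<delta>))"
        unfolding A'_eq[OF w] c_def by (rule cost_power_le[OF pos[OF w] \<open>\<delta> > 0\<close>])
      then show "norm (cost (A' \<omega>) (B \<omega>) ^ 4)
        \<le> norm (27 + c * (A \<omega> powr \<delta> + A \<omega> powr (- \<delta>)) + c * (2 powr \<delta> * (1 + \<bar>B \<omega>\<bar> powr \<delta>)))"
        by simp
    qed
  qed (simp add: cost_def)
  have ln_sq_pos: "0 < (\<integral>\<omega>. (ln (A' \<omega>))\<^sup>2 \<partial>M)"
  proof (rule ccontr)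
    assume "\<not> ?thesis"
    moreover have "0 \<le> (\<integral>\<omega>. (ln (A' \<omega>))\<^sup>2 \<partial>M)" by (intro Bochner_Integration.integral_nonneg) simp
    ultimately have "(\<integral>\<omega>. (ln (A' \<omega>))\<^sup>2 \<partial>M) = 0" by simp
    moreover have "integrable M (\<lambda>\<omega>. (ln (A' \<omega>))\<^sup>2)"
    proof (rule Bochner_Integration.integrable_bound[OF cost_int])
      show "AE \<omega> in M. norm ((ln (A' \<omega>))\<^sup>2) \<le> norm (cost (A' \<omega>) (B \<omega>) ^ 4)"
      proof (rule AE_I2)
        fix \<omega>
        have "(ln (A' \<omega>))\<^sup>2 \<le> cost (A' \<omega>) (B \<omega>) ^ 2" by (rule abs_le_square_iff[THEN iffD1]) (simp add: cost_def)
        also have "\<dots> \<le> cost (A' \<omega>) (B \<omega>) ^ 4" by (intro power_increasing) auto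
        finally show "norm ((ln (A' \<omega>))\<^sup>2) \<le> norm (cost (A' \<omega>) (B \<omega>) ^ 4)" by simp
      qed
    qed simp
    ultimately have "AE \<omega> in M. (ln (A' \<omega>))\<^sup>2 = 0"
      by (subst (asm) integral_nonneg_eq_0_iff_AE) auto
    then have "AE \<omega> in M. A \<omega> = 1"
      using AE_space by eventually_elim (use A'_eq pos in fastforce)
    with ii show False by blast
  qed
  have sets_\<nu>: "sets \<nu> = sets borel" and fin_\<nu>: "\<And>K. compact K \<Longrightarrow> emeasure \<nu> K < \<infinity>"
    using \<nu> by (auto simp: invariant_radon_measure_def radon_measure_def)
  note [measurable_cong] = sets_\<nu>
  interpret \<nu>: sigma_finite_measure \<nu> by (rule sigma_finite_if_finite_on_compact[OF sets_\<nu> fin_\<nu>])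
  interpret P: critical_affine_recursion M A' B \<nu>
  proof
    show "(\<integral>\<omega>. ln (A' \<omega>) \<partial>M) = 0" using i(2) A'_eq by (simp cong: Bochner_Integration.integral_cong)
    show "(\<integral>\<^sup>+ \<omega>. (\<integral>\<^sup>+ x. f (A' \<omega> * x + B \<omega>) \<partial>\<nu>) \<partial>M) = (\<integral>\<^sup>+ x. f x \<partial>\<nu>)"
      if f [measurable]: "f \<in> borel_measurable borel" for f :: "real \<Rightarrow> ennreal"
    proof -
      have "(\<lambda>g. \<integral>\<^sup>+ x. f (affine_act g x) \<partial>\<nu>) \<in> borel_measurable borel"
        unfolding affine_act_def by measurable
      then have m: "(\<lambda>g. \<integral>\<^sup>+ x. f (affine_act g x) \<partial>\<nu>) \<in> borel_measurable affine_borel"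
        by (rule measurable_restrict_space1)
      have "(\<integral>\<^sup>+ x. f x \<partial>\<nu>) = (\<integral>\<^sup>+ g. (\<integral>\<^sup>+ x. f (affine_act g x) \<partial>\<nu>) \<partial>\<mu>)"
        using \<nu> f by (simp add: invariant_radon_measure_def)
      also have "\<dots> = (\<integral>\<^sup>+ \<omega>. (\<integral>\<^sup>+ x. f (affine_act (?g \<omega>) x) \<partial>\<nu>) \<partial>M)"
        unfolding assms(5)[symmetric] by (rule nn_integral_distr[OF assms(4)]) (use m in simp)
      also have "\<dots> = (\<integral>\<^sup>+ \<omega>. (\<integral>\<^sup>+ x. f (A' \<omega> * x + B \<omega>) \<partial>\<nu>) \<partial>M)"
        by (intro nn_integral_cong) (simp add: affine_act_def A'_eq)
      finally show ?thesis by simp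
    qed
    show "H = UNIV"
      if H: "closed H" "\<And>y z. y \<in> H \<Longrightarrow> z \<in> H \<Longrightarrow> y + z \<in> H"
        "\<And>y. (\<And>r. 0 < r \<Longrightarrow> 0 < M.prob {\<omega> \<in> space M. \<bar>ln (A' \<omega>) - y\<bar> < r}) \<Longrightarrow> y \<in> H"
      for H
    proof (rule closed_additive_set_eq_UNIV[OF v H(1,2)])
      fix h assume h: "h \<in> measure_support \<mu>" "h \<in> affine_group"
      show "ln (snd h) \<in> H"
      proof (rule H(3))
        fix r :: real assume r: "0 < r"
        \<comment> \<open>\<open>U\<close> constrains only the dilation part, so its positive mass
          near the support point \<open>h\<close> yields a positive probability for
          \<open>ln A'\<close> near \<open>ln (snd h)\<close>.\<close>
        define U where "U = (UNIV :: real set) \<times> {exp (ln (snd h) - r)<..<exp (ln (snd h) + r)}"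
        have h0: "0 < snd h" using h(2) by (auto simp: affine_group_def)
        have "open U" unfolding U_def by (intro open_Times) auto
        moreover have "exp (ln (snd h) - r) < exp (ln (snd h))" "exp (ln (snd h)) < exp (ln (snd h) + r)"
          using r by (simp_all only: exp_less_cancel_iff)
        then have "exp (ln (snd h) - r) < snd h" "snd h < exp (ln (snd h) + r)"
          unfolding exp_ln[OF h0] by simp_all
        then have "h \<in> U" unfolding U_def mem_Times_iff by simp
        ultimately have "0 < emeasure \<mu> (U \<inter> space \<mu>)" using h(1) by (auto simp: measure_support_def)
        also have "\<dots> = emeasure M (?g -` (U \<inter> affine_group) \<inter> space M)"
        proof -
          have "U \<inter> affine_group \<in> sets affine_borel" using borel_open[OF \<open>open U\<close>]
            by (auto simp: sets_restrict_space)
          then show ?thesis unfolding assms(5)[symmetric] by (simp add: emeasure_distr[OF assms(4)] space_restrict_space)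
        qed
        also have "\<dots> \<le> emeasure M {\<omega> \<in> space M. \<bar>ln (A' \<omega>) - ln (snd h)\<bar> < r}"
        proof (intro emeasure_mono subsetI)
          fix \<omega> assume "\<omega> \<in> ?g -` (U \<inter> affine_group) \<inter> space M"
          then have w: "\<omega> \<in> space M" "exp (ln (snd h) - r) < A \<omega>" "A \<omega> < exp (ln (snd h) + r)" by (auto simp: U_def)
          then have "ln (snd h) - r < ln (A \<omega>)" "ln (A \<omega>) < ln (snd h) + r"
            using pos[OF w(1)] by (metis exp_less_cancel_iff exp_ln)+
          then show "\<omega> \<in> {\<omega> \<in> space M. \<bar>ln (A' \<omega>) - ln (snd h)\<bar> < r}" using w(1) A'_eq by auto
        qed simp
        finally show "0 < M.prob {\<omega> \<in> space M. \<bar>ln (A' \<omega>) - ln (snd h)\<bar> < r}"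
          by (simp add: M.emeasure_eq_measure)
      qed
    qed
  qed (use A'_pos cost_int ln_sq_pos sets_\<nu> fin_\<nu> in auto)
  interpret N: critical_affine_recursion M A' "\<lambda>\<omega>. - B \<omega>" "distr \<nu> borel uminus" by (rule P.reflected)
  show ?thesis
  proof (intro exI allI impI conjI; elim conjE)
    fix \<alpha> \<beta> :: real assume ab: "0 < \<alpha>" "\<alpha> < \<beta>"
    show "((\<lambda>x. measure \<nu> {\<alpha> * x<..\<beta> * x}) \<longlongrightarrow> ln (\<beta> / \<alpha>) * P.C_lim) at_top"
      by (rule P.interval_limit[OF ab]) auto
    \<comment> \<open>The interval is closed on the left because reflection turns it into one closed
      on the right, as the claim at minus infinity needs.\<close>
    have "((\<lambda>x. measure (distr \<nu> borel uminus) {\<alpha> * x..<\<beta> * x}) \<longlongrightarrow> ln (\<beta> / \<alpha>) * N.C_lim) at_top"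
      by (rule N.interval_limit[OF ab]) auto
    moreover have "measure (distr \<nu> borel uminus) {\<alpha> * x..<\<beta> * x} = measure \<nu> {\<beta> * (- x)<..\<alpha> * (- x)}" for x
    proof -
      have "uminus -` {\<alpha> * x..<\<beta> * x} = {\<beta> * (- x)<..\<alpha> * (- x)}" by auto
      then show ?thesis by (simp add: measure_distr)
    qed
    ultimately show "((\<lambda>x. measure \<nu> {\<beta> * x<..\<alpha> * x}) \<longlongrightarrow> ln (\<beta> / \<alpha>) * N.C_lim) at_bot"
      by (simp add: filterlim_at_bot_mirror)
  qed
qed

end
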